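(* Let $X$ and $Y$ be Banach spaces such that $X$ has property $(R_p)$ and $Y$ has property $(R_q)$ for some $1<p,q<\infty$ satisfying $1/p+1/q\geq 1$. Let $(x_n)_{n\in\mathbb{N}}$ and $(y_n)_{n\in\mathbb{N}}$ be weakly Cauchy sequences in $X$ and $Y$, respectively, without norm convergent subsequences. Then $(x_n\otimes y_n)_{n\in\mathbb{N}}$ admits an $\ell_1$-subsequence in $X\widehat{\otimes}_\pi Y$, that is, a subsequence which is an $\ell_1$-sequence.
   Context: All Banach spaces are real; an operator is a continuous linear map between Banach spaces. $X\widehat{\otimes}_\pi Y$ denotes the projective tensor product of $X$ and $Y$. An $\ell_1$-sequence in a Banach space is a basic sequence which is equivalent to the usual basis of $\ell_1$. Property $(R_p)$ (for $1<p<\infty$): a Banach space $X$ has property $(R_p)$ if for every relatively weakly compact set $A\subseteq X$ which is not relatively norm compact there is an operator $u:X\to\ell_p$ such that $u(A)$ is not relatively norm compact. *)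

theory Defs
  imports "HOL-Analysis.Analysis" "HOL-Analysis.Finite_Function_Topology"
begin

section \<open>The algebraic tensor product\<close>

text \<open>The free vector space over \<open>'a \<times> 'b\<close> is the type of finitely supported functions
  \<^typ>\<open>('a \<times> 'b) \<Rightarrow>\<^sub>0 real\<close>; \<^term>\<open>Poly_Mapping.single (x, y) c\<close> is \<open>c\<close> times the
  basis vector \<open>(x, y)\<close>.\<close>

definition tensor_relations ::
  "(('a::real_vector \<times> 'b::real_vector) \<Rightarrow>\<^sub>0 real) set" where
  "tensor_relations =
     {Poly_Mapping.single (x + x', y) 1 - Poly_Mapping.single (x, y) 1
        - Poly_Mapping.single (x', y) 1 | x x' y. True} \<union>
     {Poly_Mapping.single (x, y + y') 1 - Poly_Mapping.single (x, y) 1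
        - Poly_Mapping.single (x, y') 1 | x y y'. True} \<union>
     {Poly_Mapping.single (c *\<^sub>R x, y) 1 - Poly_Mapping.single (x, y) c | c x y. True} \<union>
     {Poly_Mapping.single (x, c *\<^sub>R y) 1 - Poly_Mapping.single (x, y) c | c x y. True}"

quotient_type (overloaded) ('a, 'b) tensor =
  "('a::real_vector \<times> 'b::real_vector) \<Rightarrow>\<^sub>0 real" /
  "\<lambda>f g. f - g \<in> span tensor_relations"
proof (rule equivpI)
  show "reflp (\<lambda>f g. f - g \<in> span (tensor_relations :: (('a \<times> 'b) \<Rightarrow>\<^sub>0 real) set))"
    by (auto intro!: reflpI span_zero)
  show "symp (\<lambda>f g. f - g \<in> span (tensor_relations :: (('a \<times> 'b) \<Rightarrow>\<^sub>0 real) set))"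
    by (rule sympI) (metis minus_diff_eq span_neg)
  show "transp (\<lambda>f g. f - g \<in> span (tensor_relations :: (('a \<times> 'b) \<Rightarrow>\<^sub>0 real) set))"
  proof (rule transpI)
    fix f g h :: "('a \<times> 'b) \<Rightarrow>\<^sub>0 real"
    assume "f - g \<in> span tensor_relations" "g - h \<in> span tensor_relations"
    then have "(f - g) + (g - h) \<in> span tensor_relations" by (rule span_add)
    then show "f - h \<in> span tensor_relations" by simp
  qed
qed

lemma lookup_scaleR: "Poly_Mapping.lookup (c *\<^sub>R f) k = c *\<^sub>R Poly_Mapping.lookup f k"
proof -
  have "finite {k. c *\<^sub>R Poly_Mapping.lookup f k \<noteq> 0}"
    by (rule finite_subset[OF _ finite_keys[of f]]) (auto simp: in_keys_iff)
  then show ?thesis by (simp add: scaleR_poly_mapping_def Abs_poly_mapping_inverse)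
qed

instantiation tensor :: (real_vector, real_vector) real_vector
begin

lift_definition zero_tensor :: "('a, 'b) tensor" is 0 .

lift_definition plus_tensor :: "('a, 'b) tensor \<Rightarrow> ('a, 'b) tensor \<Rightarrow> ('a, 'b) tensor" is "(+)"
  by (metis add_diff_add span_add)

lift_definition uminus_tensor :: "('a, 'b) tensor \<Rightarrow> ('a, 'b) tensor" is uminus
  by (metis minus_diff_minus span_neg)

lift_definition minus_tensor :: "('a, 'b) tensor \<Rightarrow> ('a, 'b) tensor \<Rightarrow> ('a, 'b) tensor" is "(-)"
proof -
  fix f f' g g' :: "('a \<times> 'b) \<Rightarrow>\<^sub>0 real"
  assume "f - f' \<in> span tensor_relations" "g - g' \<in> span tensor_relations"
  then have "(f - f') - (g - g') \<in> span tensor_relations" by (rule span_diff)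
  then show "f - g - (f' - g') \<in> span tensor_relations" by (simp add: algebra_simps)
qed

lift_definition scaleR_tensor :: "real \<Rightarrow> ('a, 'b) tensor \<Rightarrow> ('a, 'b) tensor" is "scaleR"
  by (metis scaleR_diff_right span_scale)

instance
  by standard (transfer; simp add: algebra_simps span_zero)+

end

lift_definition tensor :: "'a::real_vector \<Rightarrow> 'b::real_vector \<Rightarrow> ('a, 'b) tensor" is
  "\<lambda>x y. Poly_Mapping.single (x, y) 1" .

lemma bilinear_tensor:
  "bilinear (tensor :: 'a::real_vector \<Rightarrow> 'b::real_vector \<Rightarrow> ('a, 'b) tensor)"
proof -
  have sc: "c *\<^sub>R Poly_Mapping.single k 1 = Poly_Mapping.single k c" for c and k :: "'a \<times> 'b"
    by (rule poly_mapping_eqI) (simp add: lookup_scaleR lookup_single when_def)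
  have a: "tensor (x + x') y = tensor x y + tensor x' y" for x x' :: 'a and y :: 'b
    by transfer (rule span_base, force simp: tensor_relations_def algebra_simps)
  have b: "tensor x (y + y') = tensor x y + tensor x y'" for x :: 'a and y y' :: 'b
    by transfer (rule span_base, force simp: tensor_relations_def algebra_simps)
  have c: "tensor (c *\<^sub>R x) y = c *\<^sub>R tensor x y" for c and x :: 'a and y :: 'b
    by transfer (rule span_base, force simp: tensor_relations_def sc)
  have d: "tensor x (c *\<^sub>R y) = c *\<^sub>R tensor x y" for c and x :: 'a and y :: 'b
    by transfer (rule span_base, force simp: tensor_relations_def sc)
  show ?thesis
    unfolding bilinear_def by (auto intro!: linearI simp: a b c d)
qed

lemma tensor_sum_list_exists:
  fixes u :: "('a::real_vector, 'b::real_vector) tensor"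
  shows "\<exists>zs. u = (\<Sum>(x, y)\<leftarrow>zs. tensor x y)"
proof -
  have add: "\<exists>zs. v + w = (\<Sum>(x, y)\<leftarrow>zs. tensor x y)"
    if vw: "\<exists>zs. v = (\<Sum>(x, y)\<leftarrow>zs. tensor x y)" "\<exists>zs. w = (\<Sum>(x, y)\<leftarrow>zs. tensor x y)"
    for v w :: "('a, 'b) tensor"
  proof -
    obtain xs ys where "v = (\<Sum>(x, y)\<leftarrow>xs. tensor x y)" "w = (\<Sum>(x, y)\<leftarrow>ys. tensor x y)"
      using vw by blast
    then have "v + w = (\<Sum>(x, y)\<leftarrow>xs @ ys. tensor x y)" by simp
    then show ?thesis by blast
  qed
  have sc: "c *\<^sub>R Poly_Mapping.single k 1 = Poly_Mapping.single k c" for c and k :: "'a \<times> 'b"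
    by (rule poly_mapping_eqI) (simp add: lookup_scaleR lookup_single when_def)
  have single: "abs_tensor (Poly_Mapping.single (x, y) c) = tensor (c *\<^sub>R x) y"
    for c and x :: 'a and y :: 'b
    using bilinear_lmul[OF bilinear_tensor, of c x y]
    by (simp add: tensor.abs_eq scaleR_tensor.abs_eq sc)
  have "\<exists>zs. abs_tensor f = (\<Sum>(x, y)\<leftarrow>zs. tensor x y)" for f :: "('a \<times> 'b) \<Rightarrow>\<^sub>0 real"
  proof (induction f rule: update_induct)
    case const
    show ?case by (rule exI[of _ "[]"]) (simp add: zero_tensor_def)
  next
    case (update f k c)
    obtain x y where k: "k = (x, y)" by (cases k)
    have "Poly_Mapping.update k c f = f + Poly_Mapping.single k c"
      using update by (intro poly_mapping_eqI)
        (auto simp: lookup_update lookup_add lookup_single in_keys_iff when_def)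
    then have "abs_tensor (Poly_Mapping.update k c f) = abs_tensor f + tensor (c *\<^sub>R x) y"
      by (simp add: plus_tensor.abs_eq[symmetric] single k)
    moreover have "\<exists>zs. tensor (c *\<^sub>R x) y = (\<Sum>(x, y)\<leftarrow>zs. tensor x y)"
      by (rule exI[of _ "[(c *\<^sub>R x, y)]"]) simp
    ultimately show ?case using add update by metis
  qed
  from this[of "rep_tensor u"] show ?thesis
    by (simp only: Quotient3_abs_rep[OF Quotient3_tensor])
qed

text \<open>The universal property, confirming that \<^typ>\<open>('a, 'b) tensor\<close> is the tensor product.\<close>

lemma tensor_universal:
  fixes B :: "'a::real_vector \<Rightarrow> 'b::real_vector \<Rightarrow> 'c::real_vector"
  assumes "bilinear B"
  shows "\<exists>!L. linear L \<and> (\<forall>x y. L (tensor x y) = B x y)"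
proof -
  define F where "F f = (\<Sum>k\<in>Poly_Mapping.keys f. Poly_Mapping.lookup f k *\<^sub>R B (fst k) (snd k))"
    for f :: "('a \<times> 'b) \<Rightarrow>\<^sub>0 real"
  have F_eq: "F f = (\<Sum>k\<in>K. Poly_Mapping.lookup f k *\<^sub>R B (fst k) (snd k))"
    if "finite K" "Poly_Mapping.keys f \<subseteq> K" for f K
    unfolding F_def using that by (intro sum.mono_neutral_left) (auto simp: in_keys_iff)
  have linF: "linear F"
  proof (rule linearI)
    fix f g :: "('a \<times> 'b) \<Rightarrow>\<^sub>0 real" and c :: real
    let ?K = "Poly_Mapping.keys f \<union> Poly_Mapping.keys g"
    have "Poly_Mapping.keys (f + g) \<subseteq> ?K" by (rule Poly_Mapping.keys_add)
    then show "F (f + g) = F f + F g"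
      by (simp add: F_eq[of ?K] lookup_add scaleR_add_left sum.distrib)
    have "Poly_Mapping.keys (c *\<^sub>R f) \<subseteq> Poly_Mapping.keys f"
      by (auto simp: in_keys_iff lookup_scaleR)
    then show "F (c *\<^sub>R f) = c *\<^sub>R F f"
      by (simp add: F_eq[of "Poly_Mapping.keys f"] lookup_scaleR scaleR_sum_right)
  qed
  have Fs: "F (Poly_Mapping.single (x, y) c) = c *\<^sub>R B x y" for x y c
    by (simp add: F_eq[of "{(x, y)}"])
  have rel: "F f = 0" if "f \<in> tensor_relations" for f
    using that unfolding tensor_relations_def
    by (auto simp: linear_diff[OF linF] Fs bilinear_ladd[OF assms] bilinear_radd[OF assms]
        bilinear_lmul[OF assms] bilinear_rmul[OF assms])
  have ker: "F f = F g" if "f - g \<in> span tensor_relations" for f g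
  proof -
    have "F (f - g) = 0"
      using linear_eq_0_on_span[OF linF rel] that by blast
    then show ?thesis by (simp add: linear_diff[OF linF])
  qed
  define L where "L u = F (rep_tensor u)" for u
  have Labs: "L (abs_tensor f) = F f" for f
    unfolding L_def by (rule ker) (rule rep_abs_rsp_left[OF Quotient3_tensor], simp add: span_zero)
  have "linear L"
  proof (rule linearI)
    fix u v :: "('a, 'b) tensor" and c :: real
    obtain f g where "u = abs_tensor f" "v = abs_tensor g" by (metis Quotient3_abs_rep[OF Quotient3_tensor])
    then show "L (u + v) = L u + L v" "L (c *\<^sub>R u) = c *\<^sub>R L u"
      by (simp_all add: plus_tensor.abs_eq scaleR_tensor.abs_eq Labs linear_add[OF linF]
          linear_scale[OF linF])
  qed
  moreover have "L (tensor x y) = B x y" for x y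
    by (simp add: tensor.abs_eq Labs Fs)
  moreover have "M = L" if "linear M" "\<forall>x y. M (tensor x y) = B x y" for M
  proof
    fix u :: "('a, 'b) tensor"
    obtain zs where u: "u = (\<Sum>(x, y)\<leftarrow>zs. tensor x y)"
      using tensor_sum_list_exists by blast
    have "M (\<Sum>(x, y)\<leftarrow>zs. tensor x y) = L (\<Sum>(x, y)\<leftarrow>zs. tensor x y)"
      using that \<open>linear L\<close> \<open>\<And>x y. L (tensor x y) = B x y\<close>
      by (induction zs) (auto simp: linear_0 linear_add)
    then show "M u = L u" by (simp add: u)
  qed
  ultimately show ?thesis by blast
qed


section \<open>The projective norm\<close>

definition proj_norm :: "('a::real_normed_vector, 'b::real_normed_vector) tensor \<Rightarrow> real" where
  "proj_norm u = Inf {\<Sum>(x, y)\<leftarrow>zs. norm x * norm y | zs. u = (\<Sum>(x, y)\<leftarrow>zs. tensor x y)}"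

lemma sum_list_norm_nonneg: "0 \<le> (\<Sum>(x, y)\<leftarrow>zs. norm x * norm y)"
  by (rule sum_list_nonneg) auto

lemma proj_norm_le:
  assumes "u = (\<Sum>(x, y)\<leftarrow>zs. tensor x y)"
  shows "proj_norm u \<le> (\<Sum>(x, y)\<leftarrow>zs. norm x * norm y)"
  unfolding proj_norm_def
  by (rule cInf_lower) (use assms sum_list_norm_nonneg in \<open>auto intro!: bdd_belowI[of _ 0]\<close>)

lemma proj_norm_approx:
  assumes "e > 0"
  obtains zs where "u = (\<Sum>(x, y)\<leftarrow>zs. tensor x y)"
    "(\<Sum>(x, y)\<leftarrow>zs. norm x * norm y) < proj_norm u + e"
proof -
  let ?S = "{\<Sum>(x, y)\<leftarrow>zs. norm x * norm y | zs. u = (\<Sum>(x, y)\<leftarrow>zs. tensor x y)}"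
  have "?S \<noteq> {}" using tensor_sum_list_exists[of u] by auto
  then have "\<exists>s\<in>?S. s < proj_norm u + e"
    using assms unfolding proj_norm_def by (intro cInf_lessD) auto
  then show ?thesis using that by auto
qed

lemma proj_norm_nonneg: "0 \<le> proj_norm u"
  unfolding proj_norm_def
  by (rule cInf_greatest) (use tensor_sum_list_exists[of u] sum_list_norm_nonneg in auto)

lemma proj_norm_triangle: "proj_norm (u + v) \<le> proj_norm u + proj_norm v"
proof (rule field_le_epsilon)
  fix e :: real assume "e > 0"
  then have "e / 2 > 0" by simp
  obtain xs where xs: "u = (\<Sum>(x, y)\<leftarrow>xs. tensor x y)"
    "(\<Sum>(x, y)\<leftarrow>xs. norm x * norm y) < proj_norm u + e / 2"
    using proj_norm_approx[OF \<open>e / 2 > 0\<close>] .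
  obtain ys where ys: "v = (\<Sum>(x, y)\<leftarrow>ys. tensor x y)"
    "(\<Sum>(x, y)\<leftarrow>ys. norm x * norm y) < proj_norm v + e / 2"
    using proj_norm_approx[OF \<open>e / 2 > 0\<close>] .
  have "proj_norm (u + v) \<le> (\<Sum>(x, y)\<leftarrow>xs @ ys. norm x * norm y)"
    by (rule proj_norm_le) (simp add: xs ys)
  then show "proj_norm (u + v) \<le> proj_norm u + proj_norm v + e" using xs ys by simp
qed

lemma proj_norm_zero: "proj_norm (0 :: ('a::real_normed_vector, 'b::real_normed_vector) tensor) = 0"
  using proj_norm_le[of "0 :: ('a, 'b) tensor" "[]"] proj_norm_nonneg[of "0 :: ('a, 'b) tensor"]
  by simp

lemma proj_norm_scaleR: "proj_norm (c *\<^sub>R u) = \<bar>c\<bar> * proj_norm u"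
proof -
  have le: "proj_norm (c *\<^sub>R u) \<le> \<bar>c\<bar> * proj_norm u" for c and u :: "('a, 'b) tensor"
  proof (rule field_le_epsilon)
    fix e :: real assume "e > 0"
    then have e: "e / (\<bar>c\<bar> + 1) > 0" by simp
    obtain zs where zs: "u = (\<Sum>(x, y)\<leftarrow>zs. tensor x y)"
      "(\<Sum>(x, y)\<leftarrow>zs. norm x * norm y) < proj_norm u + e / (\<bar>c\<bar> + 1)"
      using proj_norm_approx[OF e] .
    let ?zs = "map (\<lambda>(x, y). (c *\<^sub>R x, y)) zs"
    have "c *\<^sub>R u = (\<Sum>(x, y)\<leftarrow>?zs. tensor x y)" unfolding zs(1)
      by (induction zs) (auto simp: scaleR_add_right bilinear_lmul[OF bilinear_tensor])
    then have "proj_norm (c *\<^sub>R u) \<le> (\<Sum>(x, y)\<leftarrow>?zs. norm x * norm y)"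
      by (rule proj_norm_le)
    also have "\<dots> = \<bar>c\<bar> * (\<Sum>(x, y)\<leftarrow>zs. norm x * norm y)"
      by (induction zs) (auto simp: algebra_simps)
    also have "\<dots> \<le> \<bar>c\<bar> * (proj_norm u + e / (\<bar>c\<bar> + 1))"
      using zs(2) by (intro mult_left_mono) auto
    also have "\<dots> = \<bar>c\<bar> * proj_norm u + e * (\<bar>c\<bar> / (\<bar>c\<bar> + 1))" by (simp add: algebra_simps)
    also have "\<dots> \<le> \<bar>c\<bar> * proj_norm u + e"
      using \<open>e > 0\<close> mult_left_le[of "\<bar>c\<bar> / (\<bar>c\<bar> + 1)" e] by simp
    finally show "proj_norm (c *\<^sub>R u) \<le> \<bar>c\<bar> * proj_norm u + e" .
  qed
  show ?thesis
  proof (cases "c = 0")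
    case False
    have "proj_norm u \<le> \<bar>inverse c\<bar> * proj_norm (c *\<^sub>R u)"
      using le[of "inverse c" "c *\<^sub>R u"] False by simp
    then have "\<bar>c\<bar> * proj_norm u \<le> proj_norm (c *\<^sub>R u)"
      using False by (simp add: field_simps)
    then show ?thesis using le[of c u] by simp
  qed (simp add: proj_norm_zero)
qed

lemma proj_norm_minus: "proj_norm (- u) = proj_norm u"
  using proj_norm_scaleR[of "-1" u] by simp

lemma proj_norm_diff_commute: "proj_norm (u - v) = proj_norm (v - u)"
  using proj_norm_minus[of "u - v"] by simp

lemma proj_norm_diff_triangle: "proj_norm (u - w) \<le> proj_norm (u - v) + proj_norm (v - w)"
  using proj_norm_triangle[of "u - v" "v - w"] by simp

lemma proj_norm_abs_diff: "\<bar>proj_norm u - proj_norm v\<bar> \<le> proj_norm (u - v)"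
  using proj_norm_triangle[of "u - v" v] proj_norm_triangle[of "v - u" u]
    proj_norm_diff_commute[of u v] by simp


section \<open>The projective tensor product of normed spaces\<close>

text \<open>The completion of the algebraic tensor product for the projective norm, as the space of
  Cauchy sequences modulo null sequences. (The projective norm is definite by the Hahn-Banach
  theorem, but the construction of the completion only needs that it is a seminorm.)\<close>

definition proj_Cauchy ::
  "(nat \<Rightarrow> ('a::real_normed_vector, 'b::real_normed_vector) tensor) \<Rightarrow> bool" where
  "proj_Cauchy u \<longleftrightarrow> (\<forall>e>0. \<exists>M. \<forall>m\<ge>M. \<forall>n\<ge>M. proj_norm (u m - u n) < e)"

definition proj_null ::
  "(nat \<Rightarrow> ('a::real_normed_vector, 'b::real_normed_vector) tensor) \<Rightarrow> bool" where
  "proj_null u \<longleftrightarrow> (\<lambda>n. proj_norm (u n)) \<longlonglongrightarrow> 0"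

lemma proj_Cauchy_const: "proj_Cauchy (\<lambda>n. u)"
  by (simp add: proj_Cauchy_def proj_norm_zero)

lemma proj_Cauchy_add:
  assumes "proj_Cauchy u" "proj_Cauchy v" shows "proj_Cauchy (\<lambda>n. u n + v n)"
  unfolding proj_Cauchy_def
proof (intro allI impI)
  fix e :: real assume "e > 0"
  then have "e / 2 > 0" by simp
  then obtain M N where M: "\<forall>m\<ge>M. \<forall>n\<ge>M. proj_norm (u m - u n) < e / 2"
    and N: "\<forall>m\<ge>N. \<forall>n\<ge>N. proj_norm (v m - v n) < e / 2"
    using assms unfolding proj_Cauchy_def by meson
  have "proj_norm (u m + v m - (u n + v n)) < e" if "m \<ge> max M N" "n \<ge> max M N" for m n
  proof -
    have "proj_norm (u m - u n) < e / 2" "proj_norm (v m - v n) < e / 2"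
      using M N that by auto
    then show ?thesis
      using proj_norm_triangle[of "u m - u n" "v m - v n"] by (simp add: algebra_simps)
  qed
  then show "\<exists>M. \<forall>m\<ge>M. \<forall>n\<ge>M. proj_norm (u m + v m - (u n + v n)) < e" by blast
qed

lemma proj_Cauchy_scaleR:
  assumes "proj_Cauchy u" shows "proj_Cauchy (\<lambda>n. c *\<^sub>R u n)"
  unfolding proj_Cauchy_def
proof (intro allI impI)
  fix e :: real assume "e > 0"
  then have e: "e / (\<bar>c\<bar> + 1) > 0" by simp
  then obtain M where M: "\<forall>m\<ge>M. \<forall>n\<ge>M. proj_norm (u m - u n) < e / (\<bar>c\<bar> + 1)"
    using assms unfolding proj_Cauchy_def by meson
  have "proj_norm (c *\<^sub>R u m - c *\<^sub>R u n) < e" if "m \<ge> M" "n \<ge> M" for m n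
  proof -
    have "(\<bar>c\<bar> + 1) * proj_norm (u m - u n) < e"
      using M that by (simp add: field_simps)
    then show ?thesis
      using proj_norm_nonneg[of "u m - u n"]
      unfolding scaleR_diff_right[symmetric] proj_norm_scaleR by (simp add: distrib_right)
  qed
  then show "\<exists>M. \<forall>m\<ge>M. \<forall>n\<ge>M. proj_norm (c *\<^sub>R u m - c *\<^sub>R u n) < e" by blast
qed

lemma proj_Cauchy_uminus: "proj_Cauchy u \<Longrightarrow> proj_Cauchy (\<lambda>n. - u n)"
  using proj_Cauchy_scaleR[of u "-1"] by simp

lemma proj_Cauchy_diff:
  "proj_Cauchy u \<Longrightarrow> proj_Cauchy v \<Longrightarrow> proj_Cauchy (\<lambda>n. u n - v n)"
  using proj_Cauchy_add[OF _ proj_Cauchy_uminus, of u v] by simp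

lemma proj_null_zero: "proj_null (\<lambda>n. 0)"
  by (simp add: proj_null_def proj_norm_zero)

lemma proj_null_add:
  assumes "proj_null u" "proj_null v" shows "proj_null (\<lambda>n. u n + v n)"
proof -
  have "(\<lambda>n. proj_norm (u n) + proj_norm (v n)) \<longlonglongrightarrow> 0"
    using tendsto_add[OF assms[unfolded proj_null_def]] by simp
  then show ?thesis unfolding proj_null_def
    by (rule tendsto_sandwich[OF _ _ tendsto_const, rotated 2])
      (auto simp: proj_norm_nonneg proj_norm_triangle)
qed

lemma proj_null_scaleR: "proj_null u \<Longrightarrow> proj_null (\<lambda>n. c *\<^sub>R u n)"
  unfolding proj_null_def proj_norm_scaleR by (rule tendsto_mult_right_zero)

lemma proj_null_uminus: "proj_null u \<Longrightarrow> proj_null (\<lambda>n. - u n)"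
  by (simp add: proj_null_def proj_norm_minus)

lemma proj_null_diff: "proj_null u \<Longrightarrow> proj_null v \<Longrightarrow> proj_null (\<lambda>n. u n - v n)"
  using proj_null_add[OF _ proj_null_uminus, of u v] by simp

lemma proj_norm_convergent:
  assumes "proj_Cauchy u" shows "convergent (\<lambda>n. proj_norm (u n))"
proof (rule real_Cauchy_convergent, rule metric_CauchyI)
  fix e :: real assume "e > 0"
  then obtain M where "\<forall>m\<ge>M. \<forall>n\<ge>M. proj_norm (u m - u n) < e"
    using assms unfolding proj_Cauchy_def by meson
  then have "\<forall>m\<ge>M. \<forall>n\<ge>M. dist (proj_norm (u m)) (proj_norm (u n)) < e"
    unfolding dist_real_def using proj_norm_abs_diff le_less_trans by blast
  then show "\<exists>M. \<forall>m\<ge>M. \<forall>n\<ge>M. dist (proj_norm (u m)) (proj_norm (u n)) < e" by blast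
qed

lemma lim_proj_norm_eq:
  assumes "proj_Cauchy u" "proj_null (\<lambda>n. u n - v n)"
  shows "lim (\<lambda>n. proj_norm (u n)) = lim (\<lambda>n. proj_norm (v n))"
proof -
  have "(\<lambda>n. proj_norm (u n)) \<longlonglongrightarrow> lim (\<lambda>n. proj_norm (u n))"
    using proj_norm_convergent[OF assms(1)] by (simp add: convergent_LIMSEQ_iff)
  moreover have "(\<lambda>n. proj_norm (u n) - proj_norm (v n)) \<longlonglongrightarrow> 0"
    using assms(2) unfolding proj_null_def
    by (rule Lim_null_comparison[rotated]) (simp add: proj_norm_abs_diff)
  ultimately have "(\<lambda>n. proj_norm (u n) - (proj_norm (u n) - proj_norm (v n)))
      \<longlonglongrightarrow> lim (\<lambda>n. proj_norm (u n)) - 0"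
    by (rule tendsto_diff)
  then show ?thesis by (simp add: limI)
qed

quotient_type (overloaded) ('a, 'b) proj_tensor =
  "nat \<Rightarrow> ('a::real_normed_vector, 'b::real_normed_vector) tensor" /
  partial: "\<lambda>u v. proj_Cauchy u \<and> proj_Cauchy v \<and> proj_null (\<lambda>n. u n - v n)"
proof (rule part_equivpI)
  show "\<exists>u::nat \<Rightarrow> ('a, 'b) tensor. proj_Cauchy u \<and> proj_Cauchy u \<and> proj_null (\<lambda>n. u n - u n)"
    using proj_Cauchy_const proj_null_zero by auto
  show "symp (\<lambda>u v::nat \<Rightarrow> ('a, 'b) tensor.
      proj_Cauchy u \<and> proj_Cauchy v \<and> proj_null (\<lambda>n. u n - v n))"
    by (rule sympI) (auto dest: proj_null_uminus)
  show "transp (\<lambda>u v::nat \<Rightarrow> ('a, 'b) tensor.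
      proj_Cauchy u \<and> proj_Cauchy v \<and> proj_null (\<lambda>n. u n - v n))"
  proof (rule transpI, safe)
    fix u v w :: "nat \<Rightarrow> ('a, 'b) tensor"
    assume "proj_null (\<lambda>n. u n - v n)" "proj_null (\<lambda>n. v n - w n)"
    from proj_null_add[OF this] show "proj_null (\<lambda>n. u n - w n)" by simp
  qed
qed

instantiation proj_tensor :: (real_normed_vector, real_normed_vector) real_vector
begin

lift_definition zero_proj_tensor :: "('a, 'b) proj_tensor" is "\<lambda>n. 0"
  by (simp add: proj_Cauchy_const proj_null_zero)

lift_definition plus_proj_tensor ::
  "('a, 'b) proj_tensor \<Rightarrow> ('a, 'b) proj_tensor \<Rightarrow> ('a, 'b) proj_tensor" is
  "\<lambda>u v n. u n + v n"
  subgoal for u u' v v'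
    using proj_null_add[of "\<lambda>n. u n - u' n" "\<lambda>n. v n - v' n"]
    by (simp add: proj_Cauchy_add algebra_simps)
  done

lift_definition uminus_proj_tensor :: "('a, 'b) proj_tensor \<Rightarrow> ('a, 'b) proj_tensor" is
  "\<lambda>u n. - u n"
  subgoal for u u'
    using proj_null_uminus[of "\<lambda>n. u n - u' n"]
    by (simp add: proj_Cauchy_uminus algebra_simps)
  done

lift_definition minus_proj_tensor ::
  "('a, 'b) proj_tensor \<Rightarrow> ('a, 'b) proj_tensor \<Rightarrow> ('a, 'b) proj_tensor" is
  "\<lambda>u v n. u n - v n"
  subgoal for u u' v v'
    using proj_null_diff[of "\<lambda>n. u n - u' n" "\<lambda>n. v n - v' n"]
    by (simp add: proj_Cauchy_diff algebra_simps)
  done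

lift_definition scaleR_proj_tensor ::
  "real \<Rightarrow> ('a, 'b) proj_tensor \<Rightarrow> ('a, 'b) proj_tensor" is "\<lambda>c u n. c *\<^sub>R u n"
  subgoal for c u u'
    using proj_null_scaleR[of "\<lambda>n. u n - u' n" c]
    by (simp add: proj_Cauchy_scaleR algebra_simps)
  done

instance
proof
  fix a b c :: "('a, 'b) proj_tensor" and r s :: real
  show "a + b + c = a + (b + c)"
    by transfer (auto simp: proj_Cauchy_add proj_null_zero algebra_simps)
  show "a + b = b + a"
    by transfer (auto simp: proj_Cauchy_add proj_null_zero algebra_simps)
  show "0 + a = a"
    by transfer (auto simp: proj_null_zero)
  show "- a + a = 0"
    by transfer (auto simp: proj_null_zero proj_Cauchy_const)
  show "a - b = a + - b"
    by transfer (auto simp: proj_null_zero proj_Cauchy_diff)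
  show "r *\<^sub>R (a + b) = r *\<^sub>R a + r *\<^sub>R b"
    by transfer (auto simp: proj_null_zero proj_Cauchy_add proj_Cauchy_scaleR
        scaleR_add_right[symmetric])
  show "(r + s) *\<^sub>R a = r *\<^sub>R a + s *\<^sub>R a"
    by transfer (auto simp: proj_null_zero proj_Cauchy_scaleR scaleR_add_left[symmetric])
  show "r *\<^sub>R s *\<^sub>R a = (r * s) *\<^sub>R a"
    by transfer (auto simp: proj_null_zero proj_Cauchy_scaleR)
  show "1 *\<^sub>R a = a"
    by transfer (auto simp: proj_null_zero)
qed

end

instantiation proj_tensor :: (real_normed_vector, real_normed_vector) real_normed_vector
begin

lift_definition norm_proj_tensor :: "('a, 'b) proj_tensor \<Rightarrow> real" is
  "\<lambda>u. lim (\<lambda>n. proj_norm (u n))"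
  by (simp add: lim_proj_norm_eq)

definition dist_proj_tensor :: "('a, 'b) proj_tensor \<Rightarrow> ('a, 'b) proj_tensor \<Rightarrow> real" where
  "dist_proj_tensor u v = norm (u - v)"

definition sgn_proj_tensor :: "('a, 'b) proj_tensor \<Rightarrow> ('a, 'b) proj_tensor" where
  "sgn_proj_tensor u = u /\<^sub>R norm u"

definition uniformity_proj_tensor ::
  "(('a, 'b) proj_tensor \<times> ('a, 'b) proj_tensor) filter" where
  "uniformity_proj_tensor = (INF e\<in>{0<..}. principal {(u, v). dist u v < e})"

definition open_proj_tensor :: "('a, 'b) proj_tensor set \<Rightarrow> bool" where
  "open_proj_tensor U \<longleftrightarrow> (\<forall>u\<in>U. \<forall>\<^sub>F (u', v) in uniformity. u' = u \<longrightarrow> v \<in> U)"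

instance
proof
  fix a b :: "('a, 'b) proj_tensor" and r :: real
  show "dist a b = norm (a - b)" by (rule dist_proj_tensor_def)
  show "sgn a = a /\<^sub>R norm a" by (rule sgn_proj_tensor_def)
  show "(uniformity :: (('a, 'b) proj_tensor \<times> ('a, 'b) proj_tensor) filter)
      = (INF e\<in>{0<..}. principal {(x, y). dist x y < e})"
    by (rule uniformity_proj_tensor_def)
  show "open U = (\<forall>x\<in>U. \<forall>\<^sub>F (x', y) in uniformity. x' = x \<longrightarrow> y \<in> U)"
    for U :: "('a, 'b) proj_tensor set"
    by (rule open_proj_tensor_def)
  have lim: "(\<lambda>n. proj_norm (u n)) \<longlonglongrightarrow> lim (\<lambda>n. proj_norm (u n))"
    if "proj_Cauchy u" for u :: "nat \<Rightarrow> ('a, 'b) tensor"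
    using proj_norm_convergent[OF that] by (simp add: convergent_LIMSEQ_iff)
  show "norm a = 0 \<longleftrightarrow> a = 0"
  proof transfer
    fix u :: "nat \<Rightarrow> ('a, 'b) tensor"
    assume "proj_Cauchy u \<and> proj_Cauchy u \<and> proj_null (\<lambda>n. u n - u n)"
    then show "lim (\<lambda>n. proj_norm (u n)) = 0 \<longleftrightarrow>
        proj_Cauchy u \<and> proj_Cauchy (\<lambda>n. 0 :: ('a, 'b) tensor) \<and> proj_null (\<lambda>n. u n - 0)"
      using lim[of u] by (auto simp: proj_Cauchy_const proj_null_def intro: limI)
  qed
  show "norm (a + b) \<le> norm a + norm b"
  proof transfer
    fix u v :: "nat \<Rightarrow> ('a, 'b) tensor"
    assume "proj_Cauchy u \<and> proj_Cauchy u \<and> proj_null (\<lambda>n. u n - u n)"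
      "proj_Cauchy v \<and> proj_Cauchy v \<and> proj_null (\<lambda>n. v n - v n)"
    then show "lim (\<lambda>n. proj_norm (u n + v n))
        \<le> lim (\<lambda>n. proj_norm (u n)) + lim (\<lambda>n. proj_norm (v n))"
      using lim[OF proj_Cauchy_add[of u v]] tendsto_add[OF lim[of u] lim[of v]]
      by (auto intro!: LIMSEQ_le proj_norm_triangle)
  qed
  show "norm (r *\<^sub>R a) = \<bar>r\<bar> * norm a"
  proof transfer
    fix r and u :: "nat \<Rightarrow> ('a, 'b) tensor"
    assume "proj_Cauchy u \<and> proj_Cauchy u \<and> proj_null (\<lambda>n. u n - u n)"
    then have "(\<lambda>n. \<bar>r\<bar> * proj_norm (u n)) \<longlonglongrightarrow> \<bar>r\<bar> * lim (\<lambda>n. proj_norm (u n))"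
      using lim[of u] by (intro tendsto_mult_left) auto
    then show "lim (\<lambda>n. proj_norm (r *\<^sub>R u n)) = \<bar>r\<bar> * lim (\<lambda>n. proj_norm (u n))"
      by (simp add: proj_norm_scaleR limI)
  qed
qed

end

definition proj_embed ::
  "('a::real_normed_vector, 'b::real_normed_vector) tensor \<Rightarrow> ('a, 'b) proj_tensor" where
  "proj_embed u = abs_proj_tensor (\<lambda>n. u)"

lemma linear_proj_embed: "linear proj_embed"
  by (rule linearI)
    (simp_all add: proj_embed_def plus_proj_tensor.abs_eq scaleR_proj_tensor.abs_eq
      proj_Cauchy_const proj_null_zero)

lemma norm_proj_embed: "norm (proj_embed u) = proj_norm u"
  by (simp add: proj_embed_def norm_proj_tensor.abs_eq proj_Cauchy_const proj_null_zero limI)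

lemma abs_proj_tensor_LIMSEQ:
  assumes "proj_Cauchy u" shows "(\<lambda>n. proj_embed (u n)) \<longlonglongrightarrow> abs_proj_tensor u"
proof (rule metric_LIMSEQ_I)
  fix e :: real assume "e > 0"
  then have "e / 2 > 0" by simp
  then obtain M where M: "\<forall>m\<ge>M. \<forall>n\<ge>M. proj_norm (u m - u n) < e / 2"
    using assms unfolding proj_Cauchy_def by meson
  have "dist (proj_embed (u n)) (abs_proj_tensor u) < e" if "n \<ge> M" for n
  proof -
    have C: "proj_Cauchy (\<lambda>m. u n - u m)" by (intro proj_Cauchy_diff proj_Cauchy_const assms)
    have "dist (proj_embed (u n)) (abs_proj_tensor u) = norm (abs_proj_tensor (\<lambda>m. u n - u m))"
      by (simp add: dist_norm proj_embed_def minus_proj_tensor.abs_eq eq_onp_def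
          proj_Cauchy_const assms proj_null_zero)
    also have "\<dots> = lim (\<lambda>m. proj_norm (u n - u m))"
      by (simp add: norm_proj_tensor.abs_eq C proj_null_zero)
    also have "\<dots> \<le> e / 2"
    proof (rule LIMSEQ_le_const2)
      show "(\<lambda>m. proj_norm (u n - u m)) \<longlonglongrightarrow> lim (\<lambda>m. proj_norm (u n - u m))"
        using proj_norm_convergent[OF C] by (simp add: convergent_LIMSEQ_iff)
      show "\<exists>N. \<forall>m\<ge>N. proj_norm (u n - u m) \<le> e / 2"
        using M that by (auto intro!: exI[of _ M] less_imp_le)
    qed
    finally show ?thesis using \<open>e > 0\<close> by simp
  qed
  then show "\<exists>M. \<forall>n\<ge>M. dist (proj_embed (u n)) (abs_proj_tensor u) < e" by blast
qed

lemma proj_embed_dense: "closure (range proj_embed) = UNIV"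
proof -
  have "a \<in> closure (range proj_embed)" for a :: "('a, 'b) proj_tensor"
  proof -
    let ?u = "rep_proj_tensor a"
    have "proj_Cauchy ?u"
      using Quotient3_rep_reflp[OF Quotient3_proj_tensor, of a] by blast
    then have "(\<lambda>n. proj_embed (?u n)) \<longlonglongrightarrow> a"
      using abs_proj_tensor_LIMSEQ Quotient3_abs_rep[OF Quotient3_proj_tensor, of a] by metis
    then show ?thesis unfolding closure_sequential
      by (intro exI[of _ "\<lambda>n. proj_embed (?u n)"]) simp
  qed
  then show ?thesis by blast
qed

instance proj_tensor :: (real_normed_vector, real_normed_vector) banach
proof
  fix a :: "nat \<Rightarrow> ('a, 'b) proj_tensor"
  assume "Cauchy a"
  have "\<exists>w. dist (proj_embed w) (a n) < inverse (Suc n)" for n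
  proof -
    have "a n \<in> closure (range proj_embed)" by (simp add: proj_embed_dense)
    then show ?thesis
      unfolding closure_approachable by (metis imageE inverse_positive_iff_positive of_nat_0_less_iff
          zero_less_Suc)
  qed
  then obtain w where w: "\<And>n. dist (proj_embed (w n)) (a n) < inverse (Suc n)" by metis
  have "(\<lambda>n. proj_embed (w n) - a n) \<longlonglongrightarrow> 0"
  proof (rule Lim_null_comparison)
    show "\<forall>\<^sub>F n in sequentially. norm (proj_embed (w n) - a n) \<le> inverse (Suc n)"
      using w by (auto simp: dist_norm intro!: always_eventually less_imp_le)
    show "(\<lambda>n. inverse (real (Suc n))) \<longlonglongrightarrow> 0" by (rule LIMSEQ_inverse_real_of_nat)
  qed
  then have null: "(\<lambda>n. a n - proj_embed (w n)) \<longlonglongrightarrow> 0"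
    using tendsto_minus by fastforce
  have "Cauchy (\<lambda>n. proj_embed (w n))"
  proof (rule metric_CauchyI)
    fix e :: real assume "e > 0"
    then have "e / 3 > 0" by simp
    obtain M where M: "\<And>m n. m \<ge> M \<Longrightarrow> n \<ge> M \<Longrightarrow> dist (a m) (a n) < e / 3"
      using metric_CauchyD[OF \<open>Cauchy a\<close> \<open>e / 3 > 0\<close>] by meson
    obtain N where N: "\<And>n. n \<ge> N \<Longrightarrow> norm (a n - proj_embed (w n)) < e / 3"
      using LIMSEQ_D[OF null \<open>e / 3 > 0\<close>] by auto
    have "dist (proj_embed (w m)) (proj_embed (w n)) < e"
      if "m \<ge> max M N" "n \<ge> max M N" for m n
    proof -
      have "dist (proj_embed (w m)) (a m) < e / 3" "dist (a m) (a n) < e / 3"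
        "dist (a n) (proj_embed (w n)) < e / 3"
        using M[of m n] N[of m] N[of n] that by (auto simp: dist_norm norm_minus_commute)
      then show ?thesis
        using dist_triangle[of "proj_embed (w m)" "proj_embed (w n)" "a m"]
          dist_triangle[of "a m" "proj_embed (w n)" "a n"] by linarith
    qed
    then show "\<exists>M. \<forall>m\<ge>M. \<forall>n\<ge>M. dist (proj_embed (w m)) (proj_embed (w n)) < e" by blast
  qed
  then have "proj_Cauchy w"
    unfolding proj_Cauchy_def Cauchy_def dist_norm
    by (simp add: linear_diff[OF linear_proj_embed, symmetric] norm_proj_embed)
  then have "(\<lambda>n. proj_embed (w n) + (a n - proj_embed (w n))) \<longlonglongrightarrow> abs_proj_tensor w + 0"
    by (intro tendsto_add null abs_proj_tensor_LIMSEQ)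
  then show "convergent a" by (auto simp: convergent_def)
qed

definition ptensor ::
  "'a::real_normed_vector \<Rightarrow> 'b::real_normed_vector \<Rightarrow> ('a, 'b) proj_tensor"
  (infixl "\<otimes>\<^sub>\<pi>" 70) where
  "x \<otimes>\<^sub>\<pi> y = proj_embed (tensor x y)"


section \<open>The spaces of p-summable sequences\<close>

definition lp :: "real \<Rightarrow> (nat \<Rightarrow> real) set" where
  "lp p = {f. summable (\<lambda>n. \<bar>f n\<bar> powr p)}"

definition lp_norm :: "real \<Rightarrow> (nat \<Rightarrow> real) \<Rightarrow> real" where
  "lp_norm p f = suminf (\<lambda>n. \<bar>f n\<bar> powr p) powr (1 / p)"

definition lp_dist :: "real \<Rightarrow> (nat \<Rightarrow> real) \<Rightarrow> (nat \<Rightarrow> real) \<Rightarrow> real" where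
  "lp_dist p f g = lp_norm p (\<lambda>n. f n - g n)"

abbreviation lp_topology :: "real \<Rightarrow> (nat \<Rightarrow> real) topology" where
  "lp_topology p \<equiv> Metric_space.mtopology (lp p) (lp_dist p)"

lemma powr_add_le_weighted:
  fixes a b A B p :: real
  assumes "p \<ge> 1" "a \<ge> 0" "b \<ge> 0" "A > 0" "B > 0"
  shows "(a + b) powr p \<le>
    (A + B) powr p * (A / (A + B) * (a powr p / A powr p) + B / (A + B) * (b powr p / B powr p))"
proof -
  have small: "t powr p \<le> t" if "0 < t" "t \<le> 1" for t :: real
    using powr_mono'[of 1 p t] that assms(1) by simp
  have conv: "(t * x + (1 - t) * y) powr p \<le> t * x powr p + (1 - t) * y powr p"
    if "0 < t" "t < 1" "x \<ge> 0" "y \<ge> 0" for t x y :: real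
  proof (cases "x = 0 \<or> y = 0")
    case True
    have "(t * x) powr p \<le> t * x powr p"
      using that small[of t] by (simp add: powr_mult mult_right_mono)
    moreover have "((1 - t) * y) powr p \<le> (1 - t) * y powr p"
      using that small[of "1 - t"] by (simp add: powr_mult mult_right_mono)
    ultimately show ?thesis using True by auto
  next
    case False
    then show ?thesis
      using that convex_onD[OF powr_convex[OF assms(1)], of "1 - t" x y] by simp
  qed
  define t where "t = A / (A + B)"
  have t: "0 < t" "t < 1" "1 - t = B / (A + B)" using assms by (auto simp: t_def field_simps)
  have "a + b = (A + B) * (t * (a / A) + (1 - t) * (b / B))"
  proof -
    have "t * (a / A) = a / (A + B)" "(1 - t) * (b / B) = b / (A + B)"
      using assms unfolding t(3) by (auto simp: t_def)
    then show ?thesis using assms by (simp add: add_divide_distrib[symmetric])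
  qed
  then have "(a + b) powr p = (A + B) powr p * (t * (a / A) + (1 - t) * (b / B)) powr p"
    using assms t by (simp add: powr_mult)
  also have "\<dots> \<le> (A + B) powr p * (t * (a / A) powr p + (1 - t) * (b / B) powr p)"
    using assms t conv[of t "a / A" "b / B"] by (intro mult_left_mono) auto
  finally show ?thesis
    using assms unfolding t(3) unfolding t_def by (simp add: powr_divide)
qed

lemma lp_norm_nonneg: "0 \<le> lp_norm p f"
  by (simp add: lp_norm_def)

lemma lp_norm_powr:
  assumes "p \<ge> 1" "f \<in> lp p" shows "lp_norm p f powr p = suminf (\<lambda>n. \<bar>f n\<bar> powr p)"
  using assms suminf_nonneg[of "\<lambda>n. \<bar>f n\<bar> powr p"]
  by (simp add: lp_norm_def lp_def powr_powr)

lemma lp_norm_eq_0_iff: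
  assumes "p \<ge> 1" "f \<in> lp p" shows "lp_norm p f = 0 \<longleftrightarrow> f = (\<lambda>n. 0)"
  using assms suminf_eq_zero_iff[of "\<lambda>n. \<bar>f n\<bar> powr p"]
  by (auto simp: lp_norm_def lp_def)

lemma lp_uminus: "f \<in> lp p \<Longrightarrow> (\<lambda>n. - f n) \<in> lp p"
  by (simp add: lp_def)

lemma lp_Minkowski:
  assumes p: "p \<ge> 1" and f: "f \<in> lp p" and g: "g \<in> lp p"
  shows "(\<lambda>n. f n + g n) \<in> lp p \<and> lp_norm p (\<lambda>n. f n + g n) \<le> lp_norm p f + lp_norm p g"
proof (cases "lp_norm p f = 0 \<or> lp_norm p g = 0")
  case True
  then have "f = (\<lambda>n. 0) \<or> g = (\<lambda>n. 0)" using lp_norm_eq_0_iff assms by blast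
  then show ?thesis using f g by (auto simp: lp_norm_nonneg)
next
  case False
  define A B where "A = lp_norm p f" and "B = lp_norm p g"
  have pos: "A > 0" "B > 0"
    using False lp_norm_nonneg[of p f] lp_norm_nonneg[of p g] unfolding A_def B_def by linarith+
  define h where "h n = (A + B) powr p *
    (A / (A + B) * (\<bar>f n\<bar> powr p / A powr p) + B / (A + B) * (\<bar>g n\<bar> powr p / B powr p))" for n
  have le: "\<bar>f n + g n\<bar> powr p \<le> h n" for n
  proof -
    have "\<bar>f n + g n\<bar> powr p \<le> (\<bar>f n\<bar> + \<bar>g n\<bar>) powr p"
      using p by (intro powr_mono2) auto
    also have "\<dots> \<le> h n"
      unfolding h_def using powr_add_le_weighted[OF p _ _ pos] by simp
    finally show ?thesis .
  qed
  have "(\<lambda>n. \<bar>f n\<bar> powr p) sums A powr p" "(\<lambda>n. \<bar>g n\<bar> powr p) sums B powr p"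
    using f g lp_norm_powr[OF p] unfolding A_def B_def by (auto simp: lp_def summable_sums)
  then have "h sums ((A + B) powr p *
      (A / (A + B) * (A powr p / A powr p) + B / (A + B) * (B powr p / B powr p)))"
    unfolding h_def by (intro sums_mult sums_add sums_divide)
  moreover have "A / (A + B) * (A powr p / A powr p) + B / (A + B) * (B powr p / B powr p) = 1"
    using pos by (simp add: add_divide_distrib[symmetric])
  ultimately have h: "h sums ((A + B) powr p)" by simp
  have "summable (\<lambda>n. \<bar>f n + g n\<bar> powr p)"
    by (rule summable_comparison_test'[OF sums_summable[OF h], of 0]) (use le in auto)
  moreover from this have "suminf (\<lambda>n. \<bar>f n + g n\<bar> powr p) \<le> (A + B) powr p"
    using suminf_le[OF le _ sums_summable[OF h]] sums_unique[OF h] by simp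
  then have "lp_norm p (\<lambda>n. f n + g n) \<le> ((A + B) powr p) powr (1 / p)"
    unfolding lp_norm_def using p calculation by (intro powr_mono2 suminf_nonneg) auto
  ultimately show ?thesis
    using p pos by (simp add: lp_def powr_powr A_def B_def)
qed

lemma Metric_space_lp:
  assumes "p \<ge> 1" shows "Metric_space (lp p) (lp_dist p)"
proof
  fix f g h :: "nat \<Rightarrow> real"
  show "0 \<le> lp_dist p f g" by (simp add: lp_dist_def lp_norm_nonneg)
  show "lp_dist p f g = lp_dist p g f"
    by (simp add: lp_dist_def lp_norm_def abs_minus_commute)
  have diff: "(\<lambda>n. f n - g n) \<in> lp p" if "f \<in> lp p" "g \<in> lp p" for f g
    using lp_Minkowski[OF assms that(1) lp_uminus[OF that(2)]] by simp
  show "lp_dist p f g = 0 \<longleftrightarrow> f = g" if "f \<in> lp p" "g \<in> lp p"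
    using lp_norm_eq_0_iff[OF assms diff[OF that]] by (auto simp: lp_dist_def fun_eq_iff)
  show "lp_dist p f h \<le> lp_dist p f g + lp_dist p g h"
    if "f \<in> lp p" "g \<in> lp p" "h \<in> lp p"
    using lp_Minkowski[OF assms diff[OF that(1,2)] diff[OF that(2,3)]] by (simp add: lp_dist_def)
qed


section \<open>The weak topology and property \<open>(R\<^sub>p)\<close>\<close>

definition weak_topology :: "'a::real_normed_vector topology" where
  "weak_topology =
     topology_generated_by {\<phi> -` U | (\<phi> :: 'a \<Rightarrow> real) U. bounded_linear \<phi> \<and> open U}"

definition weakly_Cauchy :: "(nat \<Rightarrow> 'a::real_normed_vector) \<Rightarrow> bool" where
  "weakly_Cauchy x \<longleftrightarrow> (\<forall>\<phi> :: 'a \<Rightarrow> real. bounded_linear \<phi> \<longrightarrow> Cauchy (\<lambda>n. \<phi> (x n)))"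

definition relatively_compactin :: "'a topology \<Rightarrow> 'a set \<Rightarrow> bool" where
  "relatively_compactin T A \<longleftrightarrow> A \<subseteq> topspace T \<and> compactin T (T closure_of A)"

text \<open>Continuity of \<open>u\<close> as a map into \<^term>\<open>lp_topology p\<close> includes that its values lie in
  \<^term>\<open>lp p\<close>. Linearity is stated coordinatewise because \<^typ>\<open>nat \<Rightarrow> real\<close> is
  not an instance of \<^class>\<open>real_vector\<close>.\<close>

definition lp_operator :: "real \<Rightarrow> ('a::real_normed_vector \<Rightarrow> nat \<Rightarrow> real) \<Rightarrow> bool" where
  "lp_operator p u \<longleftrightarrow>
     (\<forall>n. linear (\<lambda>x. u x n)) \<and> continuous_map euclidean (lp_topology p) u"

text \<open>Used for \<open>1 < p\<close> only; \<^const>\<open>euclidean\<close> is the norm topology of \<open>'a\<close>.\<close>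

definition property_R :: "'a::banach itself \<Rightarrow> real \<Rightarrow> bool" where
  "property_R _ p \<longleftrightarrow>
     (\<forall>A :: 'a set. relatively_compactin weak_topology A \<and> \<not> relatively_compactin euclidean A \<longrightarrow>
        (\<exists>u. lp_operator p u \<and> \<not> relatively_compactin (lp_topology p) (u ` A)))"


section \<open>Basic sequences and \<open>\<ell>\<^sub>1\<close>-sequences\<close>

definition basic_sequence :: "(nat \<Rightarrow> 'a::banach) \<Rightarrow> bool" where
  "basic_sequence z \<longleftrightarrow>
     (\<forall>v \<in> closure (span (range z)). \<exists>!a :: nat \<Rightarrow> real. (\<lambda>n. a n *\<^sub>R z n) sums v)"

definition unit_seq :: "nat \<Rightarrow> nat \<Rightarrow> real" where
  "unit_seq n = (\<lambda>k. if k = n then 1 else 0)"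

text \<open>Two basic sequences are equivalent if the same scalar sequences make the corresponding
  series converge.\<close>

definition l1_sequence :: "(nat \<Rightarrow> 'a::banach) \<Rightarrow> bool" where
  "l1_sequence z \<longleftrightarrow> basic_sequence z \<and>
     (\<forall>a :: nat \<Rightarrow> real. summable (\<lambda>n. a n *\<^sub>R z n) \<longleftrightarrow>
        (\<exists>s. limitin (lp_topology 1) (\<lambda>N k. \<Sum>n<N. a n * unit_seq n k) s sequentially))"

end

theory Submission
  imports Defs
begin

text \<open>
  A bounded linear functional on \<open>X \<otimes>\<^sub>\<pi> Y\<close> is the same as a bounded bilinear form on \<open>X \<times> Y\<close>. For operators
  \<open>u : X \<rightarrow> \<ell>\<^sub>p\<close> and \<open>v : Y \<rightarrow> \<ell>\<^sub>q\<close> with \<open>1 / p + 1 / q \<ge> 1\<close>, the forms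
  \<open>(x, y) \<mapsto> \<Sum>\<^sub>k \<epsilon>\<^sub>k u(x)\<^sub>k v(y)\<^sub>k\<close> are bounded uniformly in the signs \<open>\<epsilon>\<^sub>k\<close>. If \<open>u\<close> and \<open>v\<close> mapped \<open>x\<^sub>n\<close> and
  \<open>y\<^sub>n\<close> to the unit vectors, choosing \<open>\<epsilon>\<^sub>k\<close> as the sign of the coefficient \<open>a\<^sub>k\<close> would give
  \<open>\<Sum>\<^sub>k \<bar>a\<^sub>k\<bar> \<le> C \<parallel>\<Sum>\<^sub>k a\<^sub>k x\<^sub>k \<otimes> y\<^sub>k\<parallel>\<close>. Since weakly Cauchy sequences are bounded, such a lower estimate
  makes the tensors an \<open>\<ell>\<^sub>1\<close>-sequence (\<open>l1_lower_estimate_l1_sequence\<close>).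

  Property \<open>(R\<^sub>p)\<close> provides this situation approximately. Differences of a weakly Cauchy sequence
  without norm convergent subsequence contain a weakly null sequence bounded away from 0, so some
  operator \<open>u\<close> into \<open>\<ell>\<^sub>p\<close> maps a subsequence to vectors that converge coordinatewise to some \<open>\<xi>\<close> in
  \<open>\<ell>\<^sub>p\<close>, but stay away from \<open>\<xi>\<close> in norm (\<open>property_R_operator\<close>). The same is done for \<open>Y\<close> along this
  subsequence. A gliding hump argument finds a common subsequence and common disjoint
  finite blocks of coordinates such that the differences from the limits live essentially on
  their own blocks, and all blocks lie so far out that the limits are negligible on them. Functionals
  norming the blocks then play the role of the coordinates, with matrices that are diagonal up to a
  small error (\<open>almost_diagonal_block_functionals\<close>), and the error is absorbed in
  \<open>l1_sequence_ptensor_if_almost_diagonal\<close>.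

  The weak topology enters through the Hahn-Banach theorem: norming functionals
  (\<open>norming_functional\<close>) make it Hausdorff and make weakly Cauchy sequences bounded.
\<close>

section \<open>Norming functionals\<close>

text \<open>Positive homogeneity is only required as an inequality: applying it to \<open>c\<close> and to
  \<open>inverse c\<close> yields the equality, and an inequality is easier to verify for infima of functionals.\<close>

definition sublinear :: "('a::real_vector \<Rightarrow> real) \<Rightarrow> bool" where
  "sublinear q \<longleftrightarrow> (\<forall>x y. q (x + y) \<le> q x + q y) \<and> (\<forall>c>0. \<forall>x. q (c *\<^sub>R x) \<le> c * q x)"

lemma sublinear_add: "sublinear q \<Longrightarrow> q (x + y) \<le> q x + q y"
  by (simp add: sublinear_def)

lemma sublinear_zero:
  assumes "sublinear q" shows "q 0 = 0"
proof -
  have "q (2 *\<^sub>R 0) \<le> 2 * q 0" "q ((1/2) *\<^sub>R 0) \<le> (1/2) * q 0"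
    using assms unfolding sublinear_def by (metis zero_less_numeral, metis half_gt_zero zero_less_one)
  then show ?thesis by simp
qed

lemma sublinear_scale:
  assumes "sublinear q" "c \<ge> 0" shows "q (c *\<^sub>R x) = c * q x"
proof (cases "c = 0")
  case False
  then have c: "c > 0" using assms by simp
  have "q (inverse c *\<^sub>R c *\<^sub>R x) \<le> inverse c * q (c *\<^sub>R x)"
    using assms(1) c unfolding sublinear_def by (metis positive_imp_inverse_positive)
  then have "c * q x \<le> q (c *\<^sub>R x)" using c by (simp add: field_simps)
  moreover have "q (c *\<^sub>R x) \<le> c * q x" using assms(1) c by (simp add: sublinear_def)
  ultimately show ?thesis by simp
qed (simp add: sublinear_zero[OF assms(1)])

lemma sublinear_norm: "sublinear norm"
  by (simp add: sublinear_def norm_triangle_ineq)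

lemma sublinear_neg_le: "sublinear q \<Longrightarrow> - q (- x) \<le> q x"
  using sublinear_add[of q x "- x"] sublinear_zero[of q] by simp

text \<open>The functional is the greatest sublinear \<open>r \<le> q\<close> that is linear in the direction \<open>y\<close>
  with value \<open>q y\<close> there, namely \<open>r z = inf\<^sub>t (q (z + t y) - t q y)\<close>. It serves twice: a minimal
  sublinear functional cannot be pushed down, hence is odd; and pushing the norm down at \<open>x\<close>
  prescribes the value of the norming functional at \<open>x\<close>.\<close>

lemma sublinear_push_down:
  assumes q: "sublinear q"
  obtains r where "sublinear r" "\<And>z. r z \<le> q z" "r (- y) \<le> - q y"
proof -
  define r where "r z = (INF t\<in>{0..}. q (z + t *\<^sub>R y) - t * q y)" for z
  have low: "- q (- z) \<le> q (z + t *\<^sub>R y) - t * q y" if "t \<ge> 0" for t z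
  proof -
    have "t * q y = q ((z + t *\<^sub>R y) + (- z))" using sublinear_scale[OF q that] by simp
    also have "\<dots> \<le> q (z + t *\<^sub>R y) + q (- z)" by (rule sublinear_add[OF q])
    finally show ?thesis by simp
  qed
  have le: "r z \<le> q (z + t *\<^sub>R y) - t * q y" if "t \<ge> 0" for t z
    unfolding r_def using that low by (intro cINF_lower bdd_belowI2[where m="- q (- z)"]) auto
  have ge: "m \<le> r z" if "\<And>t. t \<ge> 0 \<Longrightarrow> m \<le> q (z + t *\<^sub>R y) - t * q y" for m z
    unfolding r_def using that by (intro cINF_greatest) auto
  have "sublinear r" unfolding sublinear_def
  proof (intro conjI allI impI)
    fix z w
    have "r (z + w) \<le> (q (z + s *\<^sub>R y) - s * q y) + (q (w + t *\<^sub>R y) - t * q y)"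
      if "s \<ge> 0" "t \<ge> 0" for s t
    proof -
      have "r (z + w) \<le> q ((z + w) + (s + t) *\<^sub>R y) - (s + t) * q y"
        using that by (intro le) simp
      moreover have "(z + w) + (s + t) *\<^sub>R y = (z + s *\<^sub>R y) + (w + t *\<^sub>R y)"
        by (simp add: algebra_simps)
      ultimately show ?thesis
        using sublinear_add[OF q, of "z + s *\<^sub>R y" "w + t *\<^sub>R y"] by (simp add: algebra_simps)
    qed
    then have "r (z + w) - (q (w + t *\<^sub>R y) - t * q y) \<le> r z" if "t \<ge> 0" for t
      using that by (intro ge) (simp add: algebra_simps)
    then have "r (z + w) - r z \<le> r w"
      by (intro ge) (simp add: algebra_simps)
    then show "r (z + w) \<le> r z + r w" by simp
  next
    fix c :: real and z assume c: "c > 0"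
    have "r (c *\<^sub>R z) / c \<le> q (z + t *\<^sub>R y) - t * q y" if "t \<ge> 0" for t
    proof -
      have "r (c *\<^sub>R z) \<le> q (c *\<^sub>R z + (c * t) *\<^sub>R y) - (c * t) * q y"
        using c that by (intro le) simp
      also have "c *\<^sub>R z + (c * t) *\<^sub>R y = c *\<^sub>R (z + t *\<^sub>R y)" by (simp add: algebra_simps)
      also have "q \<dots> = c * q (z + t *\<^sub>R y)" using sublinear_scale[OF q] c by simp
      finally show ?thesis using c by (simp add: field_simps)
    qed
    then have "r (c *\<^sub>R z) / c \<le> r z" by (rule ge)
    then show "r (c *\<^sub>R z) \<le> c * r z" using c by (simp add: field_simps)
  qed
  moreover have "r z \<le> q z" for z using le[of 0 z] by simp
  moreover have "r (- y) \<le> - q y" using le[of 1 "- y"] sublinear_zero[OF q] by simp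
  ultimately show ?thesis using that by blast
qed

text \<open>For a chain, two members may be replaced by the smaller of the two, which is what makes the
  pointwise infimum subadditive.\<close>

lemma sublinear_chain_Inf:
  assumes "C \<noteq> {}" and C: "\<And>q. q \<in> C \<Longrightarrow> sublinear q"
    and below: "\<And>q z. q \<in> C \<Longrightarrow> m z \<le> q z"
    and chain: "\<And>q r. q \<in> C \<Longrightarrow> r \<in> C \<Longrightarrow> q \<le> r \<or> r \<le> q"
  shows "sublinear (\<lambda>z. INF q\<in>C. q z)" "\<And>q z. q \<in> C \<Longrightarrow> (INF q\<in>C. q z) \<le> q z"
proof -
  show le: "(INF q\<in>C. q z) \<le> q z" if "q \<in> C" for q z
    using that below by (intro cINF_lower bdd_belowI2[where m="m z"]) auto
  let ?r = "\<lambda>z. INF q\<in>C. q z"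
  have ge: "b \<le> ?r z" if "\<And>q. q \<in> C \<Longrightarrow> b \<le> q z" for b z
    using that \<open>C \<noteq> {}\<close> by (intro cINF_greatest)
  show "sublinear ?r" unfolding sublinear_def
  proof (intro conjI allI impI)
    fix z w
    have "?r (z + w) \<le> q z + s w" if "q \<in> C" "s \<in> C" for q s
    proof -
      have "\<exists>t\<in>C. t \<le> q \<and> t \<le> s" using chain[OF that] that by auto
      then obtain t where "t \<in> C" "t \<le> q" "t \<le> s" by blast
      then have "?r (z + w) \<le> t z + t w" "t z \<le> q z" "t w \<le> s w"
        using le[of t "z + w"] C[of t] sublinear_add[of t z w] by (auto simp: le_fun_def)
      then show ?thesis by simp
    qed
    then have "?r (z + w) - s w \<le> ?r z" if "s \<in> C" for s
      using that by (intro ge) (simp add: algebra_simps)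
    then have "?r (z + w) - ?r z \<le> ?r w"
      by (intro ge) (simp add: algebra_simps)
    then show "?r (z + w) \<le> ?r z + ?r w" by simp
  next
    fix c :: real and z assume c: "c > 0"
    have "?r (c *\<^sub>R z) / c \<le> q z" if "q \<in> C" for q
      using le[OF that, of "c *\<^sub>R z"] sublinear_scale[OF C[OF that], of c z] c by (simp add: field_simps)
    then have "?r (c *\<^sub>R z) / c \<le> ?r z" by (rule ge)
    then show "?r (c *\<^sub>R z) \<le> c * ?r z" using c by (simp add: field_simps)
  qed
qed

text \<open>Instead of extending a functional from a subspace step by step, Zorn's lemma is applied to the
  sublinear functionals below \<open>q\<close>: a minimal one is odd by pushing it down, and an odd sublinear
  functional is linear.\<close>

lemma sublinear_dominates_linear:
  assumes q: "sublinear q"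
  obtains f where "linear f" "\<And>z. f z \<le> q z"
proof -
  define A where "A = {r. sublinear r \<and> r \<le> q}"
  have low: "- q (- z) \<le> r z" if "r \<in> A" for r z
    using that sublinear_neg_le[of r z] unfolding A_def le_fun_def
    by (smt (verit) mem_Collect_eq)
  have "\<exists>f\<in>A. \<forall>r\<in>A. r \<le> f \<longrightarrow> r = f"
  proof (rule predicate_Zorn[of A "\<lambda>s r. r \<le> s"])
    show "partial_order_on A (relation_of (\<lambda>s r. r \<le> s) A)"
      by (rule partial_order_on_relation_ofI) auto
    fix C assume C: "C \<in> Chains (relation_of (\<lambda>s r. r \<le> s) A)"
    show "\<exists>f\<in>A. \<forall>r\<in>C. f \<le> r"
    proof (cases "C = {}")
      case True
      then show ?thesis using q by (auto simp: A_def)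
    next
      case False
      have CA: "C \<subseteq> A" and ch: "\<And>r s. r \<in> C \<Longrightarrow> s \<in> C \<Longrightarrow> r \<le> s \<or> s \<le> r"
        using C by (auto simp: Chains_def relation_of_def)
      let ?f = "\<lambda>z. INF r\<in>C. r z"
      have f: "sublinear ?f" "\<And>r z. r \<in> C \<Longrightarrow> ?f z \<le> r z"
        using sublinear_chain_Inf[OF False, of "\<lambda>z. - q (- z)"] low CA ch by (auto simp: A_def subset_iff)
      moreover have "?f z \<le> q z" for z
      proof -
        obtain r where "r \<in> C" "r z \<le> q z" using False CA by (force simp: A_def le_fun_def)
        then show ?thesis using f(2) order_trans by blast
      qed
      ultimately show ?thesis by (intro bexI[of _ ?f]) (auto simp: A_def le_fun_def)
    qed
  qed
  then obtain f where f: "sublinear f" "f \<le> q" and min: "\<And>r. sublinear r \<Longrightarrow> r \<le> f \<Longrightarrow> r = f"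
    unfolding A_def by (auto intro: order_trans)
  have neg: "f (- y) = - f y" for y
  proof -
    obtain r where r: "sublinear r" "\<And>z. r z \<le> f z" "r (- y) \<le> - f y"
      using sublinear_push_down[OF f(1)] by blast
    then have "r = f" using min by (simp add: le_fun_def)
    then show ?thesis using r sublinear_neg_le[OF f(1), of "- y"] by simp
  qed
  have "linear f"
  proof (rule linearI)
    fix z w
    have "- f (z + w) \<le> - f z - f w"
      using sublinear_add[OF f(1), of "- z" "- w"] neg[of z] neg[of w] neg[of "z + w"]
      by (simp add: algebra_simps)
    then show "f (z + w) = f z + f w" using sublinear_add[OF f(1), of z w] by simp
  next
    fix c z
    show "f (c *\<^sub>R z) = c *\<^sub>R f z"
    proof (cases "c \<ge> 0")
      case False
      then have "f (- ((- c) *\<^sub>R z)) = - ((- c) * f z)"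
        using sublinear_scale[OF f(1), of "- c" z] neg by auto
      then show ?thesis by simp
    qed (use sublinear_scale[OF f(1)] in simp)
  qed
  then show ?thesis using f(2) that by (auto simp: le_fun_def)
qed

theorem norming_functional:
  fixes x :: "'a::real_normed_vector"
  obtains \<phi> :: "'a \<Rightarrow> real" where "bounded_linear \<phi>" "\<And>z. \<bar>\<phi> z\<bar> \<le> norm z" "\<phi> x = norm x"
proof -
  obtain r :: "'a \<Rightarrow> real" where r: "sublinear r" "\<And>z. r z \<le> norm z" "r (- x) \<le> - norm x"
    using sublinear_push_down[OF sublinear_norm] by blast
  obtain f where f: "linear f" "\<And>z. f z \<le> r z" using sublinear_dominates_linear[OF r(1)] by blast
  have ab: "\<bar>f z\<bar> \<le> norm z" for z
    using f(2)[of z] f(2)[of "- z"] r(2)[of z] r(2)[of "- z"] linear_neg[OF f(1), of z] by simp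
  moreover have "f x = norm x"
    using f(2)[of "- x"] r(3) linear_neg[OF f(1), of x] ab[of x] by simp
  moreover have "bounded_linear f"
    using f(1) ab by (intro bounded_linear_intro[of _ 1]) (auto simp: linear_add linear_scale)
  ultimately show ?thesis using that by blast
qed

lemma functional_separates:
  fixes x :: "'a::real_normed_vector"
  assumes "\<And>\<phi> :: 'a \<Rightarrow> real. bounded_linear \<phi> \<Longrightarrow> \<phi> x = 0"
  shows "x = 0"
  using norming_functional[of x] assms by (metis norm_eq_zero)

section \<open>Weakly Cauchy sequences are bounded\<close>

text \<open>The uniform boundedness principle for the evaluations at \<open>x n\<close> on the dual space, which is
  complete whether or not the space itself is. The norm of the evaluation at \<open>x n\<close> is
  \<open>norm (x n)\<close> because norming functionals exist.\<close>

lemma weakly_Cauchy_bounded: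
  fixes x :: "nat \<Rightarrow> 'a::real_normed_vector"
  assumes "weakly_Cauchy x"
  obtains M where "M > 0" "\<And>n. norm (x n) \<le> M"
proof -
  define F where "F m = {\<phi> :: 'a \<Rightarrow>\<^sub>L real. \<forall>n. \<bar>blinfun_apply \<phi> (x n)\<bar> \<le> real m}" for m
  have cl: "closed (F m)" for m
  proof -
    have "F m = (\<Inter>n. {\<phi>. \<bar>blinfun_apply \<phi> (x n)\<bar> \<le> real m})" by (auto simp: F_def)
    moreover have "closed {\<phi> :: 'a \<Rightarrow>\<^sub>L real. \<bar>blinfun_apply \<phi> (x n)\<bar> \<le> real m}" for n
      by (intro closed_Collect_le continuous_intros)
    ultimately show ?thesis by (simp only:) (intro closed_INT, simp)
  qed
  have "\<phi> \<in> (\<Union>m. F m)" for \<phi>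
  proof -
    have "Cauchy (\<lambda>n. blinfun_apply \<phi> (x n))"
      using assms blinfun.bounded_linear_right unfolding weakly_Cauchy_def by blast
    then obtain K where K: "\<And>n. \<bar>blinfun_apply \<phi> (x n)\<bar> \<le> K"
      using cauchy_imp_bounded by (force simp: bounded_iff)
    obtain m where "K \<le> real m" using real_arch_simple by blast
    then have "\<phi> \<in> F m" using K order_trans by (fastforce simp: F_def)
    then show ?thesis by blast
  qed
  then have U: "(\<Union>m. F m) = UNIV" by blast
  have "\<exists>m. interior (F m) \<noteq> {}"
  proof (rule ccontr)
    assume "\<not> ?thesis"
    then have "euclidean interior_of (\<Union> (range F)) = {}"
      using cl by (intro Baire_category_alt) (auto simp: completely_metrizable_space_euclidean)
    then show False using U by simp
  qed
  \<comment> \<open>On a ball of radius \<open>r\<close> around \<open>\<phi>0\<close> all evaluations are at most \<open>m\<close>; subtracting the centre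
    costs a factor 2.\<close>
  then obtain m \<phi>0 r where r: "r > 0" "cball \<phi>0 r \<subseteq> F m"
    by (metis ex_in_conv mem_interior_cball)
  have "norm (x n) \<le> 2 * real m / r" for n
  proof -
    obtain \<psi> where \<psi>: "bounded_linear \<psi>" "\<And>z. \<bar>\<psi> z\<bar> \<le> norm z" "\<psi> (x n) = norm (x n)"
      using norming_functional by blast
    define P where "P = Blinfun \<psi>"
    have P: "blinfun_apply P = \<psi>" unfolding P_def by (rule bounded_linear_Blinfun_apply[OF \<psi>(1)])
    have "norm P \<le> 1" using \<psi>(2) by (intro norm_blinfun_bound) (auto simp: P)
    then have "\<phi>0 + r *\<^sub>R P \<in> cball \<phi>0 r" "\<phi>0 \<in> cball \<phi>0 r" using r(1)
      by (auto simp: dist_norm)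
    then have "\<phi>0 + r *\<^sub>R P \<in> F m" "\<phi>0 \<in> F m" using r(2) by blast+
    then have "\<bar>blinfun_apply (\<phi>0 + r *\<^sub>R P) (x n)\<bar> \<le> m" "\<bar>blinfun_apply \<phi>0 (x n)\<bar> \<le> m"
      unfolding F_def by blast+
    then have "r * norm (x n) \<le> 2 * m"
      using P \<psi>(3) by (simp add: blinfun.add_left blinfun.scaleR_left)
    then show ?thesis using r(1) by (simp add: field_simps)
  qed
  then show ?thesis using that[of "2 * real m / r + 1"] r(1)
    by (meson add_nonneg_pos divide_nonneg_pos mult_nonneg_nonneg of_nat_0_le_iff zero_le_numeral zero_less_one
        order_trans less_add_one less_imp_le)
qed

section \<open>Relative compactness of convergent sequences\<close>

lemma openin_weak_vimage:
  "bounded_linear \<phi> \<Longrightarrow> open U \<Longrightarrow> openin weak_topology (\<phi> -` U)" for U :: "real set"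
  unfolding weak_topology_def by (rule topology_generated_by_Basis) blast

lemma topspace_weak_topology [simp]: "topspace weak_topology = UNIV"
  using openin_subset[OF openin_weak_vimage[OF bounded_linear_zero open_UNIV]] by auto

lemma Hausdorff_weak_topology: "Hausdorff_space (weak_topology :: 'a::real_normed_vector topology)"
  unfolding Hausdorff_space_def
proof (intro allI impI, elim conjE)
  fix x y :: 'a assume "x \<noteq> y"
  then obtain \<phi> :: "'a \<Rightarrow> real" where \<phi>: "bounded_linear \<phi>" "\<phi> (x - y) \<noteq> 0"
    using functional_separates[of "x - y"] by auto
  then have "\<phi> x \<noteq> \<phi> y" by (simp add: bounded_linear.linear linear_diff)
  then obtain U V where "open U" "open V" "\<phi> x \<in> U" "\<phi> y \<in> V" "U \<inter> V = {}"
    by (meson hausdorff)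
  then show "\<exists>U V. openin weak_topology U \<and> openin weak_topology V \<and> x \<in> U \<and> y \<in> V \<and> disjnt U V"
    using openin_weak_vimage[OF \<phi>(1)] by (intro exI[of _ "\<phi> -` U"] exI[of _ "\<phi> -` V"]) (auto simp: disjnt_def)
qed

text \<open>It suffices to test convergence on the subbase that generates the weak topology.\<close>

lemma limitin_weak_topologyI:
  assumes "\<And>\<phi> :: 'a \<Rightarrow> real. bounded_linear \<phi> \<Longrightarrow> (\<lambda>n. \<phi> (z n)) \<longlonglongrightarrow> \<phi> l"
  shows "limitin (weak_topology :: 'a::real_normed_vector topology) z l sequentially"
  unfolding limitin_def
proof (intro conjI allI impI)
  fix U :: "'a set" assume "openin weak_topology U \<and> l \<in> U"
  then have "generate_topology_on {\<phi> -` U | (\<phi> :: 'a \<Rightarrow> real) U. bounded_linear \<phi> \<and> open U} U" "l \<in> U"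
    unfolding weak_topology_def by (auto dest: openin_topology_generated_by)
  then show "\<forall>\<^sub>F n in sequentially. z n \<in> U"
  proof induction
    case (Int a b)
    then show ?case by (auto intro: eventually_conj)
  next
    case (UN K)
    then obtain k where "k \<in> K" "\<forall>\<^sub>F n in sequentially. z n \<in> k" by blast
    then show ?case by (auto elim: eventually_mono)
  next
    case (Basis s)
    then obtain \<phi> :: "'a \<Rightarrow> real" and V where "s = \<phi> -` V" "bounded_linear \<phi>" "open V" by blast
    then show ?case using topological_tendstoD[OF assms, of \<phi> V] Basis by simp
  qed simp
qed simp

text \<open>Used for the weak topology as well as for the norm topology of \<open>\<ell>\<^sub>p\<close>.\<close>

lemma relatively_compactin_range_limitin:
  assumes "Hausdorff_space T" "limitin T z l sequentially" "range z \<subseteq> topspace T"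
  shows "relatively_compactin T (range z)"
proof -
  have K: "compactin T (insert l (range z))"
    by (rule compactin_sequence_with_limit[OF assms(2) _ assms(3)]) simp
  have "closedin T (insert l (range z))" using compactin_imp_closedin[OF assms(1) K] .
  then have "T closure_of (range z) \<subseteq> insert l (range z)" by (intro closure_of_minimal) auto
  then show ?thesis unfolding relatively_compactin_def
    using closed_compactin[OF K] assms(3) by simp
qed

lemma relatively_compactin_euclidean_subsequence:
  fixes z :: "nat \<Rightarrow> 'a::metric_space"
  assumes "relatively_compactin euclidean (range z)"
  obtains l r where "strict_mono (r :: nat \<Rightarrow> nat)" "(z \<circ> r) \<longlonglongrightarrow> l"
proof -
  have "seq_compact (closure (range z))"
    using assms by (simp add: relatively_compactin_def compact_eq_seq_compact_metric)
  moreover have "z n \<in> closure (range z)" for n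
    by (rule subsetD[OF closure_subset]) simp
  ultimately obtain l r where "strict_mono (r :: nat \<Rightarrow> nat)" "(z \<circ> r) \<longlonglongrightarrow> l"
    using seq_compactE[of "closure (range z)" z] by metis
  then show ?thesis by (rule that)
qed

section \<open>Norms of p-summable sequences\<close>

lemma lp_mono:
  assumes p: "p \<ge> 1" and g: "g \<in> lp p" and le: "\<And>n. \<bar>f n\<bar> \<le> \<bar>g n\<bar>"
  shows "f \<in> lp p" "lp_norm p f \<le> lp_norm p g"
proof -
  have le': "\<bar>f n\<bar> powr p \<le> \<bar>g n\<bar> powr p" for n using le[of n] p by (intro powr_mono2) auto
  have g': "summable (\<lambda>n. \<bar>g n\<bar> powr p)" using g by (simp add: lp_def)
  have f': "summable (\<lambda>n. \<bar>f n\<bar> powr p)"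
    by (rule summable_comparison_test'[OF g', of 0]) (use le' in auto)
  then show "f \<in> lp p" by (simp add: lp_def)
  show "lp_norm p f \<le> lp_norm p g"
    unfolding lp_norm_def using p suminf_le[OF le' f' g']
    by (intro powr_mono2) (auto intro!: suminf_nonneg f')
qed

lemma lp_finite_support:
  assumes "p \<ge> 1" "finite I" "\<And>n. n \<notin> I \<Longrightarrow> f n = 0"
  shows "f \<in> lp p" "lp_norm p f = (\<Sum>n\<in>I. \<bar>f n\<bar> powr p) powr (1 / p)"
proof -
  have "(\<lambda>n. \<bar>f n\<bar> powr p) sums (\<Sum>n\<in>I. \<bar>f n\<bar> powr p)"
    using assms by (intro sums_finite) auto
  then show "f \<in> lp p" "lp_norm p f = (\<Sum>n\<in>I. \<bar>f n\<bar> powr p) powr (1 / p)"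
    by (auto simp: lp_def lp_norm_def sums_iff)
qed

lemma lp_zero: "(\<lambda>n. 0) \<in> lp p" "lp_norm p (\<lambda>n. 0) = 0"
  by (auto simp: lp_def lp_norm_def)

lemma sum_powr_le_lp_norm:
  assumes "p \<ge> 1" "f \<in> lp p" "finite I"
  shows "(\<Sum>n\<in>I. \<bar>f n\<bar> powr p) \<le> lp_norm p f powr p"
  using assms unfolding lp_norm_powr[OF assms(1,2)] by (intro sum_le_suminf) (auto simp: lp_def)

lemma abs_le_lp_norm:
  assumes "p \<ge> 1" "f \<in> lp p"
  shows "\<bar>f n\<bar> \<le> lp_norm p f"
proof -
  have "\<bar>f n\<bar> powr p \<le> lp_norm p f powr p" using sum_powr_le_lp_norm[OF assms, of "{n}"] by simp
  then show ?thesis using assms powr_le_cancel_iff lp_norm_nonneg[of p f]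
    by (smt (verit, best) powr_less_mono2)
qed

lemma lp_diff:
  assumes "p \<ge> 1" "f \<in> lp p" "g \<in> lp p"
  shows "(\<lambda>n. f n - g n) \<in> lp p" "lp_norm p (\<lambda>n. f n - g n) \<le> lp_norm p f + lp_norm p g"
  using lp_Minkowski[OF assms(1,2) lp_uminus[OF assms(3)]]
  by (auto simp: lp_norm_def)

lemma lp_norm_scale:
  assumes "p \<ge> 1" "f \<in> lp p"
  shows "(\<lambda>n. c * f n) \<in> lp p" "lp_norm p (\<lambda>n. c * f n) = \<bar>c\<bar> * lp_norm p f"
proof -
  have s: "summable (\<lambda>n. \<bar>f n\<bar> powr p)" using assms by (simp add: lp_def)
  have eq: "\<bar>c * f n\<bar> powr p = \<bar>c\<bar> powr p * \<bar>f n\<bar> powr p" for n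
    by (simp add: abs_mult powr_mult)
  show "(\<lambda>n. c * f n) \<in> lp p" unfolding lp_def using s by (simp add: eq)
  show "lp_norm p (\<lambda>n. c * f n) = \<bar>c\<bar> * lp_norm p f"
    unfolding lp_norm_def eq suminf_mult[OF s]
    using assms(1) suminf_nonneg[OF s] by (simp add: powr_mult powr_powr)
qed

lemma lp_tail_small:
  assumes p: "p \<ge> 1" and f: "f \<in> lp p" and e: "e > 0"
  shows "\<forall>\<^sub>F N in sequentially. lp_norm p (\<lambda>n. if n < N then 0 else f n) \<le> e"
proof -
  have s: "summable (\<lambda>n. \<bar>f n\<bar> powr p)" using f by (simp add: lp_def)
  have "(\<lambda>n. \<bar>if n < N then 0 else f n\<bar> powr p) sums
      (suminf (\<lambda>n. \<bar>f n\<bar> powr p) - (\<Sum>n<N. \<bar>f n\<bar> powr p))" for N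
  proof -
    have "(\<lambda>n. if n \<in> {..<N} then \<bar>f n\<bar> powr p else 0) sums (\<Sum>n<N. \<bar>f n\<bar> powr p)"
      by (rule sums_If_finite_set) simp
    from sums_diff[OF summable_sums[OF s] this] show ?thesis
      by (rule sums_cong[THEN iffD1, rotated]) auto
  qed
  note tail_sums = this
  have eq: "lp_norm p (\<lambda>n. if n < N then 0 else f n) =
      (suminf (\<lambda>n. \<bar>f n\<bar> powr p) - (\<Sum>n<N. \<bar>f n\<bar> powr p)) powr (1 / p)" for N
    unfolding lp_norm_def using sums_unique[OF tail_sums[of N]] by simp
  have "(\<lambda>N. suminf (\<lambda>n. \<bar>f n\<bar> powr p) - (\<Sum>n<N. \<bar>f n\<bar> powr p)) \<longlonglongrightarrow> 0"
    using tendsto_diff[OF tendsto_const summable_LIMSEQ[OF s], of "suminf (\<lambda>n. \<bar>f n\<bar> powr p)"] by simp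
  then have "(\<lambda>N. lp_norm p (\<lambda>n. if n < N then 0 else f n)) \<longlonglongrightarrow> 0"
    unfolding eq using p
    by (intro tendsto_zero_powrI[where b="1/p"] always_eventually)
      (auto intro!: sum_le_suminf s)
  then show ?thesis using e by (auto dest!: order_tendstoD(2)[where a=e] elim!: eventually_mono)
qed

lemma lp_head_small:
  assumes p: "p \<ge> 1" and lim: "\<And>i. (\<lambda>n. g n i) \<longlonglongrightarrow> 0" and e: "e > 0"
  shows "\<forall>\<^sub>F n in sequentially. lp_norm p (\<lambda>i. if i < N then g n i else 0) \<le> e"
proof -
  have eq: "lp_norm p (\<lambda>i. if i < N then g n i else 0) = (\<Sum>i<N. \<bar>g n i\<bar> powr p) powr (1 / p)" for n
    using lp_finite_support(2)[OF p, of "{..<N}" "\<lambda>i. if i < N then g n i else 0"] by simp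
  have "(\<lambda>n. \<bar>g n i\<bar> powr p) \<longlonglongrightarrow> 0" for i
    using p by (intro tendsto_zero_powrI[where b=p] tendsto_rabs_zero lim always_eventually) auto
  then have "(\<lambda>n. \<Sum>i<N. \<bar>g n i\<bar> powr p) \<longlonglongrightarrow> 0" by (rule tendsto_null_sum)
  then have "(\<lambda>n. lp_norm p (\<lambda>i. if i < N then g n i else 0)) \<longlonglongrightarrow> 0"
    unfolding eq using p
    by (intro tendsto_zero_powrI[where b="1/p"] always_eventually) (auto intro: sum_nonneg)
  then show ?thesis using e by (auto dest!: order_tendstoD(2)[where a=e] elim!: eventually_mono)
qed

section \<open>Sequences with a lower \<open>\<ell>\<^sub>1\<close>-estimate\<close>

text \<open>Coordinates are continuous on \<open>\<ell>\<^sub>1\<close>, so the only possible limit of the partial sums is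
  \<open>a\<close> itself, and they converge to it as soon as it is summable.\<close>

lemma limitin_l1_partial_sums_iff:
  "(\<exists>s. limitin (lp_topology 1) (\<lambda>N k. \<Sum>n<N. a n * unit_seq n k) s sequentially)
    \<longleftrightarrow> summable (\<lambda>n. \<bar>a n\<bar>)"
proof -
  interpret L: Metric_space "lp 1" "lp_dist 1" by (rule Metric_space_lp) simp
  have ps: "(\<lambda>k. \<Sum>n<N. a n * unit_seq n k) = (\<lambda>k. if k < N then a k else 0)" for N
    by (auto simp: unit_seq_def if_distrib[of "(*) _"] cong: if_cong)
  have fin: "(\<lambda>k. if k < N then a k else 0) \<in> lp 1" for N
    by (rule lp_finite_support(1)[of 1 "{..<N}"]) auto
  show ?thesis
  proof
    assume "summable (\<lambda>n. \<bar>a n\<bar>)"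
    then have a: "a \<in> lp 1" by (simp add: lp_def)
    have "\<forall>\<^sub>F N in sequentially. lp_dist 1 (\<lambda>k. if k < N then a k else 0) a < e" if "e > 0" for e
    proof -
      have "\<forall>\<^sub>F N in sequentially. lp_norm 1 (\<lambda>n. if n < N then 0 else a n) \<le> e / 2"
        using lp_tail_small[OF _ a, of "e / 2"] that by simp
      then show ?thesis
      proof (rule eventually_mono)
        fix N assume "lp_norm 1 (\<lambda>n. if n < N then 0 else a n) \<le> e / 2"
        moreover have "lp_dist 1 (\<lambda>k. if k < N then a k else 0) a
            = lp_norm 1 (\<lambda>n. if n < N then 0 else a n)"
          unfolding lp_dist_def lp_norm_def by (intro arg_cong2[of _ _ _ _ "(powr)"] suminf_cong) auto
        ultimately show "lp_dist 1 (\<lambda>k. if k < N then a k else 0) a < e" using that by simp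
      qed
    qed
    then have "limitin (lp_topology 1) (\<lambda>N k. if k < N then a k else 0) a sequentially"
      unfolding L.limitin_metric using a fin by simp
    then show "\<exists>s. limitin (lp_topology 1) (\<lambda>N k. \<Sum>n<N. a n * unit_seq n k) s sequentially"
      unfolding ps by blast
  next
    assume "\<exists>s. limitin (lp_topology 1) (\<lambda>N k. \<Sum>n<N. a n * unit_seq n k) s sequentially"
    then obtain s where s: "s \<in> lp 1"
      and lim: "\<And>e. e > 0 \<Longrightarrow> \<forall>\<^sub>F N in sequentially. lp_dist 1 (\<lambda>k. if k < N then a k else 0) s < e"
      unfolding L.limitin_metric ps using fin by auto
    have "a k = s k" for k
    proof (rule ccontr)
      assume "a k \<noteq> s k"
      then obtain N where N: "N > k" "lp_dist 1 (\<lambda>k. if k < N then a k else 0) s < \<bar>a k - s k\<bar>"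
        using eventually_conj[OF eventually_gt_at_top[of k] lim[of "\<bar>a k - s k\<bar>"]]
        by (auto simp: eventually_sequentially)
      have "\<bar>(if k < N then a k else 0) - s k\<bar> \<le> lp_dist 1 (\<lambda>k. if k < N then a k else 0) s"
        unfolding lp_dist_def by (rule abs_le_lp_norm[OF _ lp_diff(1)[OF _ fin s]]) auto
      then show False using N by simp
    qed
    then have "a = s" by blast
    then show "summable (\<lambda>n. \<bar>a n\<bar>)" using s by (simp add: lp_def)
  qed
qed

lemma span_range_finite_combination:
  fixes z :: "nat \<Rightarrow> 'a::real_vector"
  assumes "v \<in> span (range z)"
  obtains a N where "\<And>M. M \<ge> N \<Longrightarrow> (\<Sum>n<M. a n *\<^sub>R z n) = v"
proof -
  let ?P = "{v. \<exists>a N. \<forall>M\<ge>N. (\<Sum>n<M. a n *\<^sub>R z n) = v}"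
  have "subspace ?P"
  proof (rule subspaceI)
    show "0 \<in> ?P" by (auto intro!: exI[of _ "\<lambda>n. 0"])
    fix v w assume "v \<in> ?P" "w \<in> ?P"
    then obtain a N b K where "\<forall>M\<ge>N. (\<Sum>n<M. a n *\<^sub>R z n) = v" "\<forall>M\<ge>K. (\<Sum>n<M. b n *\<^sub>R z n) = w"
      by auto
    then have "\<forall>M\<ge>max N K. (\<Sum>n<M. (a n + b n) *\<^sub>R z n) = v + w"
      by (simp add: scaleR_add_left sum.distrib)
    then show "v + w \<in> ?P"
      unfolding mem_Collect_eq by (rule exI[where x="max N K", THEN exI[where x="\<lambda>n. a n + b n"]])
  next
    fix c :: real and v assume "v \<in> ?P"
    then obtain a N where "\<forall>M\<ge>N. (\<Sum>n<M. a n *\<^sub>R z n) = v" by auto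
    moreover have "(\<Sum>n<M. (c * a n) *\<^sub>R z n) = c *\<^sub>R (\<Sum>n<M. a n *\<^sub>R z n)" for M
      by (simp add: scaleR_sum_right)
    ultimately have "\<forall>M\<ge>N. (\<Sum>n<M. (c * a n) *\<^sub>R z n) = c *\<^sub>R v" by simp
    then show "c *\<^sub>R v \<in> ?P"
      unfolding mem_Collect_eq by (rule exI[where x=N, THEN exI[where x="\<lambda>n. c * a n"]])
  qed
  moreover have "range z \<subseteq> ?P"
  proof safe
    fix k
    show "\<exists>a N. \<forall>M\<ge>N. (\<Sum>n<M. a n *\<^sub>R z n) = z k"
      by (rule exI[of _ "\<lambda>n. if n = k then 1 else 0"], rule exI[of _ "Suc k"])
        (auto simp: if_distrib[of "\<lambda>c. c *\<^sub>R _"] cong: if_cong)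
  qed
  ultimately have "span (range z) \<subseteq> ?P" by (rule span_minimal[rotated])
  then show ?thesis using assms that by blast
qed

text \<open>A bounded sequence with a lower \<open>\<ell>\<^sub>1\<close>-estimate on finite combinations is an
  \<open>\<ell>\<^sub>1\<close>-sequence: together with the trivial upper estimate, the map sending \<open>a\<close> in \<open>\<ell>\<^sub>1\<close> to the
  sum of the series with coefficients \<open>a\<close> is an isomorphism onto its image, and this image is closed.\<close>

context
  fixes z :: "nat \<Rightarrow> 'a::banach" and c K :: real
  assumes c: "c > 0" and K: "\<And>n. norm (z n) \<le> K"
    and lower: "\<And>(a :: nat \<Rightarrow> real) N. c * (\<Sum>n<N. \<bar>a n\<bar>) \<le> norm (\<Sum>n<N. a n *\<^sub>R z n)"
begin

lemma l1_lower_estimate_summable_iff: "summable (\<lambda>n. a n *\<^sub>R z n) \<longleftrightarrow> summable (\<lambda>n. \<bar>a n\<bar>)"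
proof
  assume "summable (\<lambda>n. a n *\<^sub>R z n)"
  then have "Bseq (\<lambda>N. \<Sum>n<N. a n *\<^sub>R z n)" by (intro convergent_imp_Bseq) (simp add: summable_iff_convergent)
  then obtain B where B: "\<And>N. norm (\<Sum>n<N. a n *\<^sub>R z n) \<le> B" unfolding Bseq_def by blast
  have "(\<Sum>n<N. \<bar>a n\<bar>) \<le> B / c" for N
    using lower[of a N] B[of N] c by (simp add: field_simps)
  then show "summable (\<lambda>n. \<bar>a n\<bar>)" by (intro summableI_nonneg_bounded) auto
next
  assume "summable (\<lambda>n. \<bar>a n\<bar>)"
  then have "summable (\<lambda>n. \<bar>a n\<bar> * K)" by (rule summable_mult2)
  then show "summable (\<lambda>n. a n *\<^sub>R z n)"
    by (rule summable_comparison_test'[of _ 0]) (auto intro!: mult_left_mono K)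
qed

lemma l1_lower_estimate_basic_sequence: "basic_sequence z"
  unfolding basic_sequence_def
proof (intro ballI ex_ex1I)
  fix v a b assume "(\<lambda>n. a n *\<^sub>R z n) sums v" "(\<lambda>n. b n *\<^sub>R z n) sums v"
  then have s: "(\<lambda>n. (a n - b n) *\<^sub>R z n) sums 0" using sums_diff by (fastforce simp: scaleR_diff_left)
  show "a = b"
  proof
    fix k
    have "c * \<bar>a k - b k\<bar> \<le> norm (\<Sum>n<N. (a n - b n) *\<^sub>R z n)" if "N > k" for N
    proof -
      have "\<bar>a k - b k\<bar> \<le> (\<Sum>n<N. \<bar>a n - b n\<bar>)" using that by (intro member_le_sum) auto
      then show ?thesis using lower[of "\<lambda>n. a n - b n" N] c
        by (meson less_imp_le mult_left_mono order_trans)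
    qed
    moreover have "(\<lambda>N. norm (\<Sum>n<N. (a n - b n) *\<^sub>R z n)) \<longlonglongrightarrow> 0"
      using s unfolding sums_def by (rule tendsto_norm_zero)
    ultimately have "c * \<bar>a k - b k\<bar> \<le> 0"
      by (intro LIMSEQ_le_const[of _ 0]) (auto intro!: exI[of _ "Suc k"])
    then show "a k = b k" using c by (simp add: mult_le_0_iff)
  qed
next
  fix v assume "v \<in> closure (span (range z))"
  then obtain w where w: "\<And>m. w m \<in> span (range z)" "w \<longlonglongrightarrow> v" unfolding closure_sequential by blast
  have "\<forall>m. \<exists>a N. \<forall>M\<ge>N. (\<Sum>n<M. a n *\<^sub>R z n) = w m"
    using span_range_finite_combination[OF w(1)] by metis
  then obtain A N where A: "\<And>m M. M \<ge> N m \<Longrightarrow> (\<Sum>n<M. A m n *\<^sub>R z n) = w m" by metis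
  have close: "c * (\<Sum>n<M. \<bar>A m n - A m' n\<bar>) \<le> norm (w m - w m')" for m m' M
  proof -
    define L where "L = max M (max (N m) (N m'))"
    have "(\<Sum>n<M. \<bar>A m n - A m' n\<bar>) \<le> (\<Sum>n<L. \<bar>A m n - A m' n\<bar>)"
      by (intro sum_mono2) (auto simp: L_def)
    then have "c * (\<Sum>n<M. \<bar>A m n - A m' n\<bar>) \<le> c * (\<Sum>n<L. \<bar>A m n - A m' n\<bar>)"
      using c by simp
    also have "\<dots> \<le> norm (\<Sum>n<L. (A m n - A m' n) *\<^sub>R z n)" by (rule lower)
    also have "(\<Sum>n<L. (A m n - A m' n) *\<^sub>R z n) = w m - w m'"
      using A[of m L] A[of m' L] by (simp add: scaleR_diff_left sum_subtractf L_def)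
    finally show ?thesis .
  qed
  have Cw: "Cauchy w" using w(2) by (rule LIMSEQ_imp_Cauchy)
  \<comment> \<open>The finite coefficient sequences \<open>A m\<close> are Cauchy in \<open>\<ell>\<^sub>1\<close>; their limit \<open>a\<close> represents \<open>v\<close>.\<close>
  have "Cauchy (\<lambda>m. A m n)" for n
  proof (rule metric_CauchyI)
    fix e :: real assume "e > 0"
    then have "c * e > 0" using c by simp
    then obtain m0 where m0: "\<And>m m'. m \<ge> m0 \<Longrightarrow> m' \<ge> m0 \<Longrightarrow> norm (w m - w m') < c * e"
      using CauchyD[OF Cw] by blast
    have "\<bar>A m n - A m' n\<bar> < e" if "m \<ge> m0" "m' \<ge> m0" for m m'
    proof -
      have "\<bar>A m n - A m' n\<bar> \<le> (\<Sum>n<Suc n. \<bar>A m n - A m' n\<bar>)" by (intro member_le_sum) auto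
      then have "c * \<bar>A m n - A m' n\<bar> < c * e"
        using close[of m m' "Suc n"] m0[OF that] c by (smt (verit) mult_left_mono)
      then show ?thesis using c by simp
    qed
    then show "\<exists>M. \<forall>m\<ge>M. \<forall>m'\<ge>M. dist (A m n) (A m' n) < e" by (auto simp: dist_real_def)
  qed
  then have "\<forall>n. \<exists>l. (\<lambda>m. A m n) \<longlonglongrightarrow> l" using real_Cauchy_convergent unfolding convergent_def by blast
  then obtain a where a: "\<And>n. (\<lambda>m. A m n) \<longlonglongrightarrow> a n" by metis
  have K0: "K \<ge> 0" using K[of 0] norm_ge_zero order_trans by blast
  have "(\<lambda>n. a n *\<^sub>R z n) sums v" unfolding sums_def
  proof (rule LIMSEQ_I)
    fix e :: real assume "e > 0"
    define d where "d = e / (2 * (K / c + 1))"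
    have Kc: "K / c + 1 > 0" using K0 c by (simp add: add_nonneg_pos)
    have d: "d > 0" unfolding d_def using \<open>e > 0\<close> Kc by simp
    have "(K / c + 1) * d = e / 2" unfolding d_def using Kc
      by (metis nonzero_mult_divide_mult_cancel_left less_irrefl mult.commute times_divide_eq_right)
    then have ed: "(K / c) * d + d < e" using \<open>e > 0\<close> by (simp add: distrib_right)
    obtain m0 where m0: "\<And>m m'. m \<ge> m0 \<Longrightarrow> m' \<ge> m0 \<Longrightarrow> norm (w m - w m') < d"
      using CauchyD[OF Cw d] by blast
    obtain m1 where m1: "\<And>m. m \<ge> m1 \<Longrightarrow> norm (w m - v) < d"
      using LIMSEQ_D[OF w(2) d] by blast
    define m where "m = max m0 m1"
    have "norm ((\<Sum>n<M. a n *\<^sub>R z n) - v) < e" if "M \<ge> N m" for M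
    proof -
      have "c * (\<Sum>n<M. \<bar>A m n - a n\<bar>) \<le> d"
      proof (rule LIMSEQ_le_const2)
        show "(\<lambda>m'. c * (\<Sum>n<M. \<bar>A m n - A m' n\<bar>)) \<longlonglongrightarrow> c * (\<Sum>n<M. \<bar>A m n - a n\<bar>)"
          by (intro tendsto_intros a)
        show "\<exists>k. \<forall>m'\<ge>k. c * (\<Sum>n<M. \<bar>A m n - A m' n\<bar>) \<le> d"
          using close[of m _ M] m0[of m] by (intro exI[of _ m0]) (force simp: m_def intro: order_trans less_imp_le)
      qed
      then have s: "(\<Sum>n<M. \<bar>a n - A m n\<bar>) \<le> d / c" using c by (simp add: field_simps abs_minus_commute)
      have "norm (\<Sum>n<M. (a n - A m n) *\<^sub>R z n) \<le> (\<Sum>n<M. \<bar>a n - A m n\<bar> * K)"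
        by (rule sum_norm_le) (auto intro!: mult_left_mono K)
      also have "\<dots> \<le> (d / c) * K" unfolding sum_distrib_right[symmetric] using s K0 by (rule mult_right_mono)
      finally have "norm (\<Sum>n<M. (a n - A m n) *\<^sub>R z n) \<le> (K / c) * d" by (simp add: mult.commute)
      moreover have eq: "(\<Sum>n<M. a n *\<^sub>R z n) - v = (\<Sum>n<M. (a n - A m n) *\<^sub>R z n) + (w m - v)"
        using A[OF that] by (simp add: scaleR_diff_left sum_subtractf)
      moreover have "norm (w m - v) < d" by (rule m1) (simp add: m_def)
      ultimately show ?thesis unfolding eq using ed norm_triangle_ineq[of "\<Sum>n<M. (a n - A m n) *\<^sub>R z n" "w m - v"]
        by linarith
    qed
    then show "\<exists>k. \<forall>M\<ge>k. norm ((\<Sum>n<M. a n *\<^sub>R z n) - v) < e" by blast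
  qed
  then show "\<exists>a. (\<lambda>n. a n *\<^sub>R z n) sums v" by blast
qed

lemma l1_lower_estimate_l1_sequence: "l1_sequence z"
  unfolding l1_sequence_def limitin_l1_partial_sums_iff l1_lower_estimate_summable_iff
  using l1_lower_estimate_basic_sequence by simp

end

section \<open>Operators into the spaces of p-summable sequences\<close>

lemma lp_operator_bound:
  fixes u :: "'a::real_normed_vector \<Rightarrow> nat \<Rightarrow> real"
  assumes p: "p \<ge> 1" and u: "lp_operator p u"
  obtains C where "C > 0" "\<And>x. u x \<in> lp p" "\<And>x. lp_norm p (u x) \<le> C * norm x"
proof -
  interpret L: Metric_space "lp p" "lp_dist p" by (rule Metric_space_lp[OF p])
  have cont: "continuous_map euclidean L.mtopology u" and lin: "\<And>n. linear (\<lambda>x. u x n)"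
    using u by (auto simp: lp_operator_def)
  have ulp: "u x \<in> lp p" for x using continuous_map_image_subset_topspace[OF cont] by auto
  have u0: "u 0 = (\<lambda>n. 0)" using linear_0[OF lin] by (rule ext)
  let ?V = "{x \<in> topspace euclidean. u x \<in> L.mball (\<lambda>n. 0) 1}"
  have "openin euclidean ?V" using cont L.openin_mball by (rule openin_continuous_map_preimage)
  then have "open ?V" by (simp only: open_openin)
  moreover have "0 \<in> ?V" using lp_zero by (simp add: u0 lp_dist_def)
  ultimately obtain e where e: "e > 0" "ball 0 e \<subseteq> ?V" unfolding open_contains_ball by blast
  have "lp_norm p (u x) \<le> (2 / e) * norm x" for x
  proof (cases "x = 0")
    case True
    then show ?thesis using lp_zero by (simp add: u0)
  next
    case False
    define s where "s = e / (2 * norm x)"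
    have s: "s > 0" using False e by (simp add: s_def)
    have "s *\<^sub>R x \<in> ball 0 e" using False e by (simp add: s_def)
    then have "u (s *\<^sub>R x) \<in> L.mball (\<lambda>n. 0) 1" using e(2) by blast
    then have "lp_norm p (u (s *\<^sub>R x)) < 1" by (simp add: lp_dist_def lp_norm_def)
    moreover have "u (s *\<^sub>R x) = (\<lambda>n. s * u x n)" using linear_scale[OF lin] by (intro ext) simp
    ultimately have "s * lp_norm p (u x) < 1" using lp_norm_scale[OF p ulp, of s x] s by simp
    then show ?thesis using False e(1) by (simp add: s_def field_simps)
  qed
  then show ?thesis using e(1) ulp by (intro that[of "2 / e"]) auto
qed

text \<open>Fatou's lemma for the counting measure, applied to finite partial sums.\<close>

lemma lp_coordinatewise_limit:
  assumes p: "p \<ge> 1" and f: "\<And>n. f n \<in> lp p" and M: "\<And>n. lp_norm p (f n) \<le> M"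
    and lim: "\<And>k. (\<lambda>n. f n k) \<longlonglongrightarrow> \<xi> k"
  shows "\<xi> \<in> lp p"
proof -
  have "(\<Sum>k<N. \<bar>\<xi> k\<bar> powr p) \<le> M powr p" for N
  proof (rule LIMSEQ_le_const2)
    show "(\<lambda>n. \<Sum>k<N. \<bar>f n k\<bar> powr p) \<longlonglongrightarrow> (\<Sum>k<N. \<bar>\<xi> k\<bar> powr p)"
      using p by (intro tendsto_sum tendsto_powr' tendsto_rabs lim tendsto_const) auto
    have "(\<Sum>k<N. \<bar>f n k\<bar> powr p) \<le> M powr p" for n
    proof -
      have "(\<Sum>k<N. \<bar>f n k\<bar> powr p) \<le> lp_norm p (f n) powr p"
        by (rule sum_powr_le_lp_norm[OF p f]) simp
      also have "\<dots> \<le> M powr p" using p M lp_norm_nonneg by (intro powr_mono2) auto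
      finally show ?thesis .
    qed
    then show "\<exists>N0. \<forall>n\<ge>N0. (\<Sum>k<N. \<bar>f n k\<bar> powr p) \<le> M powr p" by blast
  qed
  then show ?thesis unfolding lp_def mem_Collect_eq by (rule summableI_nonneg_bounded[rotated]) simp
qed

lemma weakly_Cauchy_coordinate_limit:
  fixes x :: "nat \<Rightarrow> 'a::real_normed_vector"
  assumes p: "p \<ge> 1" and lin: "\<And>n. linear (\<lambda>x. u x n)" and ulp: "\<And>x. u x \<in> lp p"
    and C: "\<And>x. lp_norm p (u x) \<le> C * norm x" and C0: "C > 0" and x: "weakly_Cauchy x"
  obtains \<xi> where "\<xi> \<in> lp p" "\<And>k. (\<lambda>n. u (x n) k) \<longlonglongrightarrow> \<xi> k"
proof -
  have "bounded_linear (\<lambda>x. u x k)" for k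
  proof (rule bounded_linear_intro[of _ C])
    show "norm (u x k) \<le> norm x * C" for x
      using order_trans[OF abs_le_lp_norm[OF p ulp] C, of x k] by (simp add: mult.commute)
  qed (simp_all add: linear_add[OF lin] linear_scale[OF lin])
  then have "Cauchy (\<lambda>n. u (x n) k)" for k using x unfolding weakly_Cauchy_def by blast
  then have "\<forall>k. \<exists>l. (\<lambda>n. u (x n) k) \<longlonglongrightarrow> l"
    using real_Cauchy_convergent unfolding convergent_def by blast
  then obtain \<xi> where \<xi>: "\<And>k. (\<lambda>n. u (x n) k) \<longlonglongrightarrow> \<xi> k" by metis
  obtain M where M: "M > 0" "\<And>n. norm (x n) \<le> M" using weakly_Cauchy_bounded[OF x] by blast
  have "lp_norm p (u (x n)) \<le> C * M" for n
    using C[of "x n"] mult_left_mono[OF M(2)[of n], of C] C0 by linarith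
  then have "\<xi> \<in> lp p" by (rule lp_coordinatewise_limit[OF p ulp _ \<xi>])
  then show ?thesis using \<xi> that by blast
qed

text \<open>The sequence need not converge weakly, so property \<open>(R\<^sub>p)\<close> is applied to differences
  \<open>x (m N) - x (n N)\<close> of norm at least \<open>e\<close>, which are weakly null. The resulting operator \<open>u\<close> does not
  send them to a norm null sequence; hence \<open>u (x n)\<close> does not converge in norm to its
  coordinatewise limit \<open>\<xi>\<close>.\<close>

lemma property_R_operator:
  fixes x :: "nat \<Rightarrow> 'a::banach"
  assumes p: "1 < p" and R: "property_R TYPE('a) p" and x: "weakly_Cauchy x"
    and nc: "\<not> convergent x"
  obtains u C \<xi> d and r :: "nat \<Rightarrow> nat" where "\<And>n. linear (\<lambda>x::'a. u x n)" "\<And>x. u x \<in> lp p" "C > 0"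
    "\<And>x. lp_norm p (u x) \<le> C * norm x" "\<xi> \<in> lp p" "\<And>k. (\<lambda>n. u (x n) k) \<longlonglongrightarrow> \<xi> k"
    "d > 0" "strict_mono r" "\<And>n. d \<le> lp_norm p (\<lambda>k. u (x (r n)) k - \<xi> k)"
proof -
  have p1: "p \<ge> 1" using p by simp
  interpret L: Metric_space "lp p" "lp_dist p" by (rule Metric_space_lp[OF p1])
  have "\<not> Cauchy x" using nc by (simp add: Cauchy_convergent_iff)
  then obtain e where e: "e > 0" "\<And>N. \<exists>m\<ge>N. \<exists>n\<ge>N. norm (x m - x n) \<ge> e"
    unfolding Cauchy_iff by (meson not_le)
  then obtain m n where mn: "\<And>N. m N \<ge> N" "\<And>N. n N \<ge> N" "\<And>N. norm (x (m N) - x (n N)) \<ge> e"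
    by metis
  have m: "filterlim m at_top sequentially" and n: "filterlim n at_top sequentially"
    using mn(1,2) by (auto intro: filterlim_at_top_mono[OF filterlim_ident])
  define z where "z N = x (m N) - x (n N)" for N
  have z0: "(\<lambda>N. \<phi> (z N)) \<longlonglongrightarrow> 0" if \<phi>: "bounded_linear \<phi>" for \<phi> :: "'a \<Rightarrow> real"
  proof -
    obtain l where l: "(\<lambda>N. \<phi> (x N)) \<longlonglongrightarrow> l"
      using x \<phi> real_Cauchy_convergent unfolding weakly_Cauchy_def convergent_def by blast
    have "(\<lambda>N. \<phi> (x (m N)) - \<phi> (x (n N))) \<longlonglongrightarrow> l - l"
      by (intro tendsto_diff filterlim_compose[OF l] m n)
    then show ?thesis using \<phi> by (simp add: z_def linear_diff bounded_linear.linear)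
  qed
  have "limitin weak_topology z 0 sequentially"
    by (rule limitin_weak_topologyI) (simp add: z0 linear_0 bounded_linear.linear)
  then have "relatively_compactin weak_topology (range z)"
    by (intro relatively_compactin_range_limitin Hausdorff_weak_topology) auto
  moreover have "\<not> relatively_compactin euclidean (range z)"
  proof
    assume "relatively_compactin euclidean (range z)"
    then obtain l s where s: "strict_mono (s :: nat \<Rightarrow> nat)" "(z \<circ> s) \<longlonglongrightarrow> l"
      by (rule relatively_compactin_euclidean_subsequence)
    have "\<phi> l = 0" if \<phi>: "bounded_linear \<phi>" for \<phi> :: "'a \<Rightarrow> real"
      using bounded_linear.tendsto[OF \<phi> s(2)] LIMSEQ_subseq_LIMSEQ[OF z0[OF \<phi>] s(1)]
      by (intro LIMSEQ_unique) (auto simp: o_def)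
    then have "l = 0" by (rule functional_separates)
    moreover have "e \<le> norm l"
      using tendsto_norm[OF s(2)] mn(3) by (intro LIMSEQ_le_const) (auto simp: z_def)
    ultimately show False using e(1) by simp
  qed
  ultimately obtain u where u: "lp_operator p u" "\<not> relatively_compactin (lp_topology p) (u ` range z)"
    using R unfolding property_R_def by blast
  then have lin: "\<And>n. linear (\<lambda>x. u x n)" by (simp add: lp_operator_def)
  obtain C where C: "C > 0" "\<And>x. u x \<in> lp p" "\<And>x. lp_norm p (u x) \<le> C * norm x"
    using lp_operator_bound[OF p1 u(1)] by blast
  obtain \<xi> where \<xi>: "\<xi> \<in> lp p" "\<And>k. (\<lambda>n. u (x n) k) \<longlonglongrightarrow> \<xi> k"
    using weakly_Cauchy_coordinate_limit[OF p1 lin C(2,3,1) x] by blast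
  define W where "W N = lp_norm p (\<lambda>k. u (x N) k - \<xi> k)" for N
  \<comment> \<open>If \<open>u (x n)\<close> converged to \<open>\<xi>\<close>, the images of the differences would tend to 0 and hence form a
    relatively compact set.\<close>
  have "\<not> W \<longlonglongrightarrow> 0"
  proof
    assume W: "W \<longlonglongrightarrow> 0"
    have le: "lp_dist p (u (z N)) (\<lambda>k. 0) \<le> W (m N) + W (n N)" for N
    proof -
      have "u (z N) = (\<lambda>k. (u (x (m N)) k - \<xi> k) - (u (x (n N)) k - \<xi> k))"
        using linear_diff[OF lin] by (intro ext) (simp add: z_def)
      moreover have "lp_dist p (u (z N)) (\<lambda>k. 0) = lp_norm p (u (z N))"
        by (simp add: lp_dist_def)
      ultimately show ?thesis
        using lp_diff(2)[OF p1 lp_diff(1)[OF p1 C(2) \<xi>(1)] lp_diff(1)[OF p1 C(2) \<xi>(1)], of "x (m N)" "x (n N)"]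
        by (simp add: W_def)
    qed
    have "(\<lambda>N. W (m N) + W (n N)) \<longlonglongrightarrow> 0"
      using tendsto_add[OF filterlim_compose[OF W m] filterlim_compose[OF W n]] by simp
    then have "(\<lambda>N. lp_dist p (u (z N)) (\<lambda>k. 0)) \<longlonglongrightarrow> 0"
      by (rule tendsto_sandwich[OF _ _ tendsto_const, rotated 2]) (simp_all add: le)
    then have "limitin L.mtopology (\<lambda>N. u (z N)) (\<lambda>k. 0) sequentially"
      unfolding L.limitin_metric_dist_null using lp_zero C(2) by simp
    then have "relatively_compactin L.mtopology (range (\<lambda>N. u (z N)))"
      using C(2) by (intro relatively_compactin_range_limitin L.Hausdorff_space_mtopology) auto
    then show False using u(2) by (simp add: image_image)
  qed
  then obtain d where d: "d > 0" "\<And>N. \<exists>n\<ge>N. d \<le> W n"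
    using lp_norm_nonneg unfolding LIMSEQ_iff W_def
    by (metis abs_of_nonneg diff_zero not_le real_norm_def)
  then have "infinite {n. d \<le> W n}" unfolding infinite_nat_iff_unbounded_le by blast
  then obtain r :: "nat \<Rightarrow> nat" where "strict_mono r" "\<And>n. d \<le> W (r n)"
    using infinite_enumerate by (metis mem_Collect_eq)
  then show ?thesis using that[OF lin C(2,1,3) \<xi> d(1)] by (simp add: W_def)
qed

section \<open>Blocks and gliding humps\<close>

text \<open>The equality case of Hoelder's inequality on a finite set: \<open>\<alpha> i\<close> is
  \<open>sgn (w i) * \<bar>w i\<bar> powr (p - 1)\<close>, normalised in the dual exponent. The second conclusion says that
  \<open>\<alpha>\<close> has norm at most 1, in the form that can be summed over disjoint blocks.\<close>

lemma lp_block_norming_functional: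
  fixes w :: "nat \<Rightarrow> real"
  assumes p: "1 < p" and I: "finite I"
  obtains \<alpha> where "(\<Sum>i\<in>I. \<alpha> i * w i) = (\<Sum>i\<in>I. \<bar>w i\<bar> powr p) powr (1 / p)"
    "\<And>f. \<bar>\<Sum>i\<in>I. \<alpha> i * f i\<bar> powr p \<le> (\<Sum>i\<in>I. \<bar>f i\<bar> powr p)"
proof -
  define S where "S = (\<Sum>i\<in>I. \<bar>w i\<bar> powr p)"
  have "S \<ge> 0" unfolding S_def by (intro sum_nonneg) auto
  show ?thesis
  proof (cases "S = 0")
    case True
    show ?thesis by (rule that[of "\<lambda>i. 0"]) (use True in \<open>auto simp: S_def sum_nonneg\<close>)
  next
    case False
    then have S: "S > 0" using \<open>S \<ge> 0\<close> by simp
    define q where "q = p / (p - 1)"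
    have q: "q > 1" "1 / p + 1 / q = 1" "(p - 1) * q = p"
      using p by (auto simp: q_def field_simps)
    define W where "W = S powr (1 / p)"
    have W: "W > 0" "W powr p = S" using S p by (auto simp: W_def powr_powr)
    define \<alpha> where "\<alpha> i = sgn (w i) * \<bar>w i\<bar> powr (p - 1) / W powr (p - 1)" for i
    have \<alpha>w: "\<alpha> i * w i = \<bar>w i\<bar> powr p / W powr (p - 1)" for i
    proof (cases "w i = 0")
      case False
      then have "\<bar>w i\<bar> powr (p - 1) * \<bar>w i\<bar> = \<bar>w i\<bar> powr p"
        by (simp add: powr_diff)
      moreover have "sgn (w i) * w i = \<bar>w i\<bar>" by (simp add: abs_sgn)
      ultimately show ?thesis by (simp add: \<alpha>_def) (metis mult.assoc mult.commute)
    qed (use p in \<open>simp add: \<alpha>_def\<close>)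
    have "(\<Sum>i\<in>I. \<alpha> i * w i) = W powr p / W powr (p - 1)"
      unfolding \<alpha>w sum_divide_distrib[symmetric] S_def[symmetric] W(2) ..
    also have "\<dots> = W" using W(1) by (simp add: powr_diff)
    finally have 1: "(\<Sum>i\<in>I. \<alpha> i * w i) = W" .
    have \<alpha>q: "\<bar>\<alpha> i\<bar> powr q = \<bar>w i\<bar> powr p / S" for i
    proof (cases "w i = 0")
      case False
      then have "\<bar>\<alpha> i\<bar> = \<bar>w i\<bar> powr (p - 1) / W powr (p - 1)"
        by (simp add: \<alpha>_def abs_mult abs_sgn_eq)
      then show ?thesis using W by (simp add: powr_divide powr_powr q(3))
    qed (use p in \<open>simp add: \<alpha>_def\<close>)
    have \<alpha>1: "(\<Sum>i\<in>I. \<bar>\<alpha> i\<bar> powr q) = 1"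
      unfolding \<alpha>q sum_divide_distrib[symmetric] S_def[symmetric] using S by simp
    have 2: "\<bar>\<Sum>i\<in>I. \<alpha> i * f i\<bar> powr p \<le> (\<Sum>i\<in>I. \<bar>f i\<bar> powr p)" for f
    proof -
      define T where "T = (\<Sum>i\<in>I. \<bar>f i\<bar> powr p)"
      have "T \<ge> 0" unfolding T_def by (intro sum_nonneg) auto
      show ?thesis
      proof (cases "T = 0")
        case True
        then have "f i = 0" if "i \<in> I" for i
          using that I unfolding T_def by (simp add: sum_nonneg_eq_0_iff)
        then show ?thesis using p by simp
      next
        case False
        then have T: "T > 0" using \<open>T \<ge> 0\<close> by simp
        define F where "F = T powr (1 / p)"
        have F: "F > 0" "F powr p = T" using T p by (auto simp: F_def powr_powr)
        have "(\<Sum>i\<in>I. \<bar>\<alpha> i\<bar> * (\<bar>f i\<bar> / F)) \<le> (\<Sum>i\<in>I. (\<bar>f i\<bar> / F) powr p / p + \<bar>\<alpha> i\<bar> powr q / q)"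
          using F(1) q(1,2) p Youngs_inequality[of p q "\<bar>f _\<bar> / F" "\<bar>\<alpha> _\<bar>"]
          by (intro sum_mono) (auto simp: mult.commute)
        also have "\<dots> = (\<Sum>i\<in>I. \<bar>f i\<bar> powr p) / F powr p / p + (\<Sum>i\<in>I. \<bar>\<alpha> i\<bar> powr q) / q"
          using F(1) by (simp add: sum.distrib powr_divide sum_divide_distrib)
        also have "\<dots> = 1" unfolding \<alpha>1 T_def[symmetric] F(2) using T q(2) by simp
        finally have "(\<Sum>i\<in>I. \<bar>\<alpha> i\<bar> * \<bar>f i\<bar>) / F \<le> 1" by (simp add: sum_divide_distrib)
        then have "(\<Sum>i\<in>I. \<bar>\<alpha> i\<bar> * \<bar>f i\<bar>) \<le> F" using F(1) by simp
        moreover have "\<bar>\<Sum>i\<in>I. \<alpha> i * f i\<bar> \<le> (\<Sum>i\<in>I. \<bar>\<alpha> i\<bar> * \<bar>f i\<bar>)"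
          using sum_abs[of "\<lambda>i. \<alpha> i * f i" I] by (simp add: abs_mult)
        ultimately have "\<bar>\<Sum>i\<in>I. \<alpha> i * f i\<bar> powr p \<le> F powr p" using p by (intro powr_mono2) auto
        then show ?thesis unfolding F(2) T_def .
      qed
    qed
    show ?thesis by (rule that[OF _ 2]) (use 1 in \<open>simp add: W_def S_def\<close>)
  qed
qed

lemma sum_consecutive_blocks:
  fixes N :: "nat \<Rightarrow> nat" and g :: "nat \<Rightarrow> 'a::comm_monoid_add"
  assumes "mono N"
  shows "(\<Sum>k<n. \<Sum>i\<in>{N k..<N (Suc k)}. g i) = (\<Sum>i\<in>{N 0..<N n}. g i)"
proof (induction n)
  case (Suc n)
  have "N 0 \<le> N n" "N n \<le> N (Suc n)" using assms by (auto simp: mono_def)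
  then show ?case using Suc by (simp add: sum.atLeastLessThan_concat)
qed simp

text \<open>Later, \<open>P n N\<close> says that the \<open>n\<close>-th vector has little mass before \<open>N\<close>, which holds for large
  \<open>n\<close>, and \<open>Q n N\<close> that it has little mass from \<open>N\<close> on, which holds for large \<open>N\<close>. Choosing alternately an
  index and a cut, the \<open>k\<close>-th chosen vector lives essentially on the block \<open>{N k..<N (Suc k)}\<close>.
  As \<open>P\<close> and \<open>Q\<close> are arbitrary, the same blocks can serve two sequences at once.\<close>

lemma gliding_hump:
  fixes P Q :: "nat \<Rightarrow> nat \<Rightarrow> bool"
  assumes P: "\<And>N. \<forall>\<^sub>F n in sequentially. P n N" and Q: "\<And>n. \<forall>\<^sub>F N in sequentially. Q n N"
  obtains r N :: "nat \<Rightarrow> nat" where "strict_mono r" "strict_mono N" "N 0 = N0"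
    "\<And>k. P (r k) (N k)" "\<And>k. Q (r k) (N (Suc k))"
proof -
  have ex: "\<exists>n N'. n > n0 \<and> N' > N \<and> P n N \<and> Q n N'" for n0 N
  proof -
    obtain n where "n > n0" "P n N"
      using eventually_happens[OF eventually_conj[OF eventually_gt_at_top[of n0] P[of N]]] by auto
    moreover obtain N' where "N' > N" "Q n N'"
      using eventually_happens[OF eventually_conj[OF eventually_gt_at_top[of N] Q[of n]]] by auto
    ultimately show ?thesis by blast
  qed
  \<comment> \<open>The \<open>k\<close>-th state consists of the chosen index, the left and the right end of its block.\<close>
  have "\<exists>s :: nat \<Rightarrow> nat \<times> nat \<times> nat. \<forall>k.
      (case s k of (n, N, N') \<Rightarrow> N' > N \<and> P n N \<and> Q n N' \<and> (k = 0 \<longrightarrow> N = N0)) \<and>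
      (case s k of (n, N, N') \<Rightarrow> case s (Suc k) of (n1, N1, N1') \<Rightarrow> n1 > n \<and> N1 = N')"
  proof (rule dependent_nat_choice)
    show "\<exists>t. case t of (n, N, N') \<Rightarrow> N' > N \<and> P n N \<and> Q n N' \<and> ((0::nat) = 0 \<longrightarrow> N = N0)"
      using ex[of 0 N0] by auto
    fix t :: "nat \<times> nat \<times> nat" and k :: nat
    show "\<exists>t'. (case t' of (n, N, N') \<Rightarrow> N' > N \<and> P n N \<and> Q n N' \<and> (Suc k = 0 \<longrightarrow> N = N0)) \<and>
      (case t of (n, N, N') \<Rightarrow> case t' of (n1, N1, N1') \<Rightarrow> n1 > n \<and> N1 = N')"
      using ex[of "fst t" "snd (snd t)"] by (cases t) auto
  qed
  then obtain s :: "nat \<Rightarrow> nat \<times> nat \<times> nat" where s: "\<And>k.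
      (case s k of (n, N, N') \<Rightarrow> N' > N \<and> P n N \<and> Q n N' \<and> (k = 0 \<longrightarrow> N = N0)) \<and>
      (case s k of (n, N, N') \<Rightarrow> case s (Suc k) of (n1, N1, N1') \<Rightarrow> n1 > n \<and> N1 = N')"
    by blast
  define r N where "r k = fst (s k)" and "N k = fst (snd (s k))" for k
  have *: "r (Suc k) > r k" "N (Suc k) > N k" "P (r k) (N k)" "Q (r k) (N (Suc k))" for k
    using s[of k] by (auto simp: r_def N_def split: prod.splits)
  moreover have "N 0 = N0" using s[of 0] by (auto simp: N_def split: prod.splits)
  ultimately show ?thesis using that[of r N] by (simp add: strict_mono_Suc_iff)
qed

text \<open>The \<open>k\<close>-th functional norms the part of \<open>f k - \<xi>\<close> on the \<open>k\<close>-th block. Then \<open>D k\<close> is the norm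
  of this part, and the matrix of the functionals on the \<open>f j\<close> is \<open>D\<close> on the diagonal up to an error
  in \<open>\<ell>\<^sub>p\<close> that comes from everything else in \<open>f j\<close>: the tail of \<open>\<xi>\<close>, and the two parts of \<open>f j - \<xi>\<close>
  before and after its block. Each contributes at most \<open>\<kappa>\<close>, whence \<open>3 * \<kappa>\<close>.\<close>

lemma almost_diagonal_block_functionals:
  fixes f :: "nat \<Rightarrow> nat \<Rightarrow> real" and N :: "nat \<Rightarrow> nat"
  assumes p: "1 < p" and f: "\<And>j. f j \<in> lp p" and \<xi>: "\<xi> \<in> lp p" and N: "strict_mono N"
    and \<xi>_tail: "lp_norm p (\<lambda>i. if i < N 0 then 0 else \<xi> i) \<le> \<kappa>"
    and head: "\<And>j. lp_norm p (\<lambda>i. if i < N j then f j i - \<xi> i else 0) \<le> \<kappa>"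
    and tail: "\<And>j. lp_norm p (\<lambda>i. if i < N (Suc j) then 0 else f j i - \<xi> i) \<le> \<kappa>"
  obtains \<alpha> :: "nat \<Rightarrow> nat \<Rightarrow> real" and D :: "nat \<Rightarrow> real"
  where
    "\<And>g n. g \<in> lp p \<Longrightarrow>
       (\<Sum>k<n. \<bar>\<Sum>i\<in>{N k..<N (Suc k)}. \<alpha> k i * g i\<bar> powr p) \<le> lp_norm p g powr p"
    "\<And>j n. (\<Sum>k<n. \<bar>(\<Sum>i\<in>{N k..<N (Suc k)}. \<alpha> k i * f j i) - (if k = j then D j else 0)\<bar> powr p)
       \<le> (3 * \<kappa>) powr p"
    "\<And>j. lp_norm p (\<lambda>i. f j i - \<xi> i) - 2 * \<kappa> \<le> D j" "\<And>j. D j \<le> lp_norm p (\<lambda>i. f j i - \<xi> i)"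
proof -
  have p1: "p \<ge> 1" using p by simp
  define I where "I k = {N k..<N (Suc k)}" for k
  have finI: "finite (I k)" for k by (simp add: I_def)
  have N_mono: "mono N" using N by (rule strict_mono_mono)
  have I_disj: "i \<notin> I k" if "i \<in> I j" "k \<noteq> j" for i j k
    using that monoD[OF N_mono, of "Suc j" k] monoD[OF N_mono, of "Suc k" j]
    by (cases "k < j") (auto simp: I_def)
  have I_ge: "N 0 \<le> i" if "i \<in> I k" for i k
    using that monoD[OF N_mono, of 0 k] by (auto simp: I_def)
  define D where "D j = (\<Sum>i\<in>I j. \<bar>f j i - \<xi> i\<bar> powr p) powr (1 / p)" for j
  have "\<forall>k. \<exists>\<alpha>. (\<Sum>i\<in>I k. \<alpha> i * (f k i - \<xi> i)) = D k \<and>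
      (\<forall>g. \<bar>\<Sum>i\<in>I k. \<alpha> i * g i\<bar> powr p \<le> (\<Sum>i\<in>I k. \<bar>g i\<bar> powr p))"
  proof
    fix k
    show "\<exists>\<alpha>. (\<Sum>i\<in>I k. \<alpha> i * (f k i - \<xi> i)) = D k \<and>
      (\<forall>g. \<bar>\<Sum>i\<in>I k. \<alpha> i * g i\<bar> powr p \<le> (\<Sum>i\<in>I k. \<bar>g i\<bar> powr p))"
      unfolding D_def
      by (rule lp_block_norming_functional[OF p finI[of k], of "\<lambda>i. f k i - \<xi> i"]) blast
  qed
  then obtain \<alpha> where \<alpha>1: "\<And>k. (\<Sum>i\<in>I k. \<alpha> k i * (f k i - \<xi> i)) = D k"
    and \<alpha>2: "\<And>k g. \<bar>\<Sum>i\<in>I k. \<alpha> k i * g i\<bar> powr p \<le> (\<Sum>i\<in>I k. \<bar>g i\<bar> powr p)"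
    using choice[of "\<lambda>k \<alpha>. (\<Sum>i\<in>I k. \<alpha> i * (f k i - \<xi> i)) = D k \<and>
      (\<forall>g. \<bar>\<Sum>i\<in>I k. \<alpha> i * g i\<bar> powr p \<le> (\<Sum>i\<in>I k. \<bar>g i\<bar> powr p))"] by blast
  have bound: "(\<Sum>k<n. \<bar>\<Sum>i\<in>I k. \<alpha> k i * g i\<bar> powr p) \<le> lp_norm p g powr p" if g: "g \<in> lp p" for g n
  proof -
    have "(\<Sum>k<n. \<bar>\<Sum>i\<in>I k. \<alpha> k i * g i\<bar> powr p) \<le> (\<Sum>k<n. \<Sum>i\<in>I k. \<bar>g i\<bar> powr p)"
      by (intro sum_mono \<alpha>2)
    also have "\<dots> = (\<Sum>i\<in>{N 0..<N n}. \<bar>g i\<bar> powr p)"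
      unfolding I_def by (rule sum_consecutive_blocks[OF N_mono])
    also have "\<dots> \<le> lp_norm p g powr p" by (rule sum_powr_le_lp_norm[OF p1 g]) simp
    finally show ?thesis .
  qed
  define W where "W j = (\<lambda>i. f j i - \<xi> i)" for j
  have W: "W j \<in> lp p" for j unfolding W_def by (rule lp_diff(1)[OF p1 f \<xi>])
  define w where "w j i = (if i \<in> I j then W j i else 0)" for j i
  have w: "w j \<in> lp p" for j by (rule lp_mono(1)[OF p1 W[of j]]) (auto simp: w_def)
  have Dw: "D j = lp_norm p (w j)" for j
    using lp_finite_support(2)[OF p1 finI, of j "w j"] by (simp add: w_def W_def D_def cong: sum.cong)
  define A where "A j = (\<lambda>i. if i < N j then W j i else 0)" for j
  define B where "B j = (\<lambda>i. if i < N (Suc j) then 0 else W j i)" for j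
  define X where "X = (\<lambda>i. if i < N 0 then 0 else \<xi> i)"
  have A: "A j \<in> lp p" and B: "B j \<in> lp p" for j
    by (rule lp_mono(1)[OF p1 W[of j]], simp add: A_def B_def)+
  have X: "X \<in> lp p" by (rule lp_mono(1)[OF p1 \<xi>]) (simp add: X_def)
  have nA: "lp_norm p (A j) \<le> \<kappa>" and nB: "lp_norm p (B j) \<le> \<kappa>" for j
    using head[of j] tail[of j] unfolding A_def B_def W_def by simp_all
  have nX: "lp_norm p X \<le> \<kappa>" using \<xi>_tail by (simp add: X_def)
  have AB: "(\<lambda>i. A j i + B j i) \<in> lp p" "lp_norm p (\<lambda>i. A j i + B j i) \<le> 2 * \<kappa>" for j
    using lp_Minkowski[OF p1 A B, of j j] nA[of j] nB[of j] by auto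
  have le: "N j \<le> N (Suc j)" for j using N_mono by (simp add: mono_def)
  have Wsplit: "W j i = w j i + (A j i + B j i)" for j i
    using le[of j] by (auto simp: w_def A_def B_def I_def)
  have D_upper: "D j \<le> lp_norm p (W j)" for j
    unfolding Dw by (rule lp_mono(2)[OF p1 W]) (simp add: w_def)
  have D_lower: "lp_norm p (W j) - 2 * \<kappa> \<le> D j" for j
  proof -
    have "W j = (\<lambda>i. w j i + (A j i + B j i))" using Wsplit by (rule ext)
    then have "lp_norm p (W j) \<le> lp_norm p (w j) + lp_norm p (\<lambda>i. A j i + B j i)"
      using lp_Minkowski[OF p1 w AB(1), of j j] by simp
    then show ?thesis unfolding Dw using AB(2)[of j] by simp
  qed
  have diag: "(\<Sum>k<n. \<bar>(\<Sum>i\<in>I k. \<alpha> k i * f j i) - (if k = j then D j else 0)\<bar> powr p)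
       \<le> (3 * \<kappa>) powr p" for j n
  proof -
    define h where "h i = X i + (A j i + B j i)" for i
    have h: "h \<in> lp p" "lp_norm p h \<le> 3 * \<kappa>"
      using lp_Minkowski[OF p1 X AB(1), of j] nX AB(2)[of j] unfolding h_def by auto
    have "(\<Sum>i\<in>I k. \<alpha> k i * f j i) - (if k = j then D j else 0) = (\<Sum>i\<in>I k. \<alpha> k i * h i)" for k
    proof -
      have "(\<Sum>i\<in>I k. \<alpha> k i * w j i) = (if k = j then D j else 0)"
        using \<alpha>1[of j] I_disj by (auto simp: w_def W_def cong: sum.cong intro!: sum.neutral)
      moreover have "f j i = w j i + h i" if "i \<in> I k" for i
        using Wsplit[of j i] I_ge[OF that] by (simp add: h_def X_def W_def)
      ultimately show ?thesis by (simp add: distrib_left sum.distrib cong: sum.cong)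
    qed
    then have "(\<Sum>k<n. \<bar>(\<Sum>i\<in>I k. \<alpha> k i * f j i) - (if k = j then D j else 0)\<bar> powr p)
        \<le> lp_norm p h powr p" using bound[OF h(1)] by simp
    also have "\<dots> \<le> (3 * \<kappa>) powr p" using h(2) p lp_norm_nonneg by (intro powr_mono2) auto
    finally show ?thesis .
  qed
  show ?thesis
    by (rule that[of \<alpha> D]) (use bound diag D_upper D_lower in \<open>simp_all add: I_def W_def\<close>)
qed

section \<open>Diagonal bilinear forms on the projective tensor product\<close>

text \<open>The condition on the exponents means that \<open>q\<close> is at most the conjugate exponent \<open>p'\<close> of \<open>p\<close>.
  After normalisation all terms are at most 1, so \<open>t powr p' \<le> t powr q\<close> and Young's inequality applies.
  This is where \<open>1 / p + 1 / q \<ge> 1\<close> enters: the diagonal form on \<open>\<ell>\<^sub>p \<times> \<ell>\<^sub>q\<close> is bounded exactly then.\<close>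

lemma sum_mult_le_two_exponents:
  fixes a b :: "'i \<Rightarrow> real"
  assumes p: "1 < p" and q: "1 < q" and pq: "1 / p + 1 / q \<ge> 1" and S: "finite S"
    and A: "A \<ge> 0" "(\<Sum>k\<in>S. \<bar>a k\<bar> powr p) \<le> A powr p"
    and B: "B \<ge> 0" "(\<Sum>k\<in>S. \<bar>b k\<bar> powr q) \<le> B powr q"
  shows "(\<Sum>k\<in>S. \<bar>a k * b k\<bar>) \<le> 2 * A * B"
proof (cases "A = 0 \<or> B = 0")
  case True
  then have "(\<Sum>k\<in>S. \<bar>a k\<bar> powr p) = 0 \<or> (\<Sum>k\<in>S. \<bar>b k\<bar> powr q) = 0"
    using A B p q by (auto simp: order_antisym sum_nonneg)
  then have "\<forall>k\<in>S. a k * b k = 0"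
    using S by (auto simp: sum_nonneg_eq_0_iff)
  then have "(\<Sum>k\<in>S. \<bar>a k * b k\<bar>) = 0" by (intro sum.neutral) simp
  then show ?thesis using A(1) B(1) by simp
next
  case False
  then have pos: "A > 0" "B > 0" using A B by auto
  define p' where "p' = p / (p - 1)"
  have p': "p' > 1" "1 / p + 1 / p' = 1" using p by (auto simp: p'_def field_simps)
  have "1 / p' \<le> 1 / q" using pq p'(2) by linarith
  then have "q \<le> p'" using p'(1) q by (simp add: field_simps)
  define s t where "s k = \<bar>a k\<bar> / A" and "t k = \<bar>b k\<bar> / B" for k
  have s0: "s k \<ge> 0" and t0: "t k \<ge> 0" for k using pos by (auto simp: s_def t_def)
  have "(\<Sum>k\<in>S. s k powr p) = (\<Sum>k\<in>S. \<bar>a k\<bar> powr p) / A powr p"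
    using pos by (simp add: s_def powr_divide sum_divide_distrib)
  then have s: "(\<Sum>k\<in>S. s k powr p) \<le> 1" using A(2) pos by simp
  have "(\<Sum>k\<in>S. t k powr q) = (\<Sum>k\<in>S. \<bar>b k\<bar> powr q) / B powr q"
    using pos by (simp add: t_def powr_divide sum_divide_distrib)
  then have t: "(\<Sum>k\<in>S. t k powr q) \<le> 1" using B(2) pos by simp
  have "s k * t k \<le> s k powr p + t k powr q" if k: "k \<in> S" for k
  proof -
    have "t k powr q \<le> (\<Sum>k\<in>S. t k powr q)" using k S by (intro member_le_sum) auto
    then have "t k \<le> 1" using t q t0[of k] by (smt (verit) powr_one_eq_one powr_less_mono2)
    then have "t k powr p' \<le> t k powr q"
      using t0[of k] \<open>q \<le> p'\<close> by (cases "t k = 0") (auto intro: powr_mono')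
    moreover have "s k * t k \<le> s k powr p / p + t k powr p' / p'"
      using Youngs_inequality[OF p p'(1,2) s0 t0] .
    moreover have "s k powr p / p \<le> s k powr p" "t k powr p' / p' \<le> t k powr p'"
      using p p'(1) mult_left_mono[of 1 p "s k powr p"] mult_left_mono[of 1 p' "t k powr p'"]
      by (simp_all add: field_simps)
    ultimately show ?thesis by linarith
  qed
  then have "(\<Sum>k\<in>S. s k * t k) \<le> (\<Sum>k\<in>S. s k powr p + t k powr q)" by (rule sum_mono)
  also have "\<dots> \<le> 2" using s t by (simp add: sum.distrib)
  finally have "(\<Sum>k\<in>S. s k * t k) \<le> 2" .
  moreover have "(\<Sum>k\<in>S. s k * t k) = (\<Sum>k\<in>S. \<bar>a k * b k\<bar>) / (A * B)"
    by (simp add: s_def t_def sum_divide_distrib abs_mult)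
  ultimately show ?thesis using pos by (simp add: field_simps)
qed

text \<open>A bounded bilinear form induces a linear functional on the algebraic tensor product that is
  bounded for the projective norm.\<close>

lemma bilinear_form_le_norm_ptensor:
  fixes B :: "'a::real_normed_vector \<Rightarrow> 'b::real_normed_vector \<Rightarrow> real"
  assumes B: "bilinear B" and C: "C \<ge> 0" "\<And>x y. \<bar>B x y\<bar> \<le> C * (norm x * norm y)"
  shows "\<bar>\<Sum>j<n. a j * B (x j) (y j)\<bar> \<le> C * norm (\<Sum>j<n. a j *\<^sub>R (x j \<otimes>\<^sub>\<pi> y j))"
proof -
  obtain L where L: "linear L" "\<And>x y. L (tensor x y) = B x y"
    using tensor_universal[OF B] by blast
  have bound: "\<bar>L u\<bar> \<le> C * proj_norm u" for u
  proof (rule field_le_epsilon)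
    fix e :: real assume e: "e > 0"
    then have "e / (C + 1) > 0" using C(1) by simp
    then obtain zs where zs: "u = (\<Sum>(x, y)\<leftarrow>zs. tensor x y)"
      "(\<Sum>(x, y)\<leftarrow>zs. norm x * norm y) < proj_norm u + e / (C + 1)"
      by (rule proj_norm_approx)
    have "\<bar>L (\<Sum>(x, y)\<leftarrow>zs. tensor x y)\<bar> \<le> C * (\<Sum>(x, y)\<leftarrow>zs. norm x * norm y)"
    proof (induction zs)
      case (Cons w zs)
      obtain v v' where w: "w = (v, v')" by (cases w)
      show ?case using Cons C(2)[of v v']
        by (simp add: w linear_add[OF L(1)] L(2) distrib_left)
    qed (simp add: linear_0[OF L(1)])
    also have "\<dots> \<le> C * (proj_norm u + e / (C + 1))"
      using zs(2) C(1) by (intro mult_left_mono) auto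
    also have "\<dots> \<le> C * proj_norm u + e"
      using C(1) e by (simp add: field_simps)
    finally show "\<bar>L u\<bar> \<le> C * proj_norm u + e" unfolding zs(1)[symmetric] .
  qed
  have "(\<Sum>j<n. a j * B (x j) (y j)) = L (\<Sum>j<n. a j *\<^sub>R tensor (x j) (y j))"
    by (simp add: linear_sum[OF L(1)] linear_scale[OF L(1)] L(2))
  moreover have "(\<Sum>j<n. a j *\<^sub>R (x j \<otimes>\<^sub>\<pi> y j)) = proj_embed (\<Sum>j<n. a j *\<^sub>R tensor (x j) (y j))"
    by (simp add: ptensor_def linear_sum[OF linear_proj_embed] linear_scale[OF linear_proj_embed])
  ultimately show ?thesis using bound norm_proj_embed by metis
qed

lemma norm_ptensor_le: "norm (x \<otimes>\<^sub>\<pi> y) \<le> norm x * norm y"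
  using proj_norm_le[of "tensor x y" "[(x, y)]"] by (simp add: ptensor_def norm_proj_embed)

text \<open>If the matrices of \<open>a\<close> and \<open>b\<close> on the two sequences were exactly diagonal, the form
  \<open>F v w = (\<Sum>k<n. sgn (\<mu> k) * (a k v * b k w))\<close> would take the value \<open>(\<Sum>j<n. \<bar>\<mu> j\<bar> * D j * E j)\<close> on
  \<open>(\<Sum>j<n. \<mu> j *\<^sub>R (x j \<otimes>\<^sub>\<pi> y j))\<close>. Its bound \<open>2 * A * B\<close> does not depend on the signs or on \<open>n\<close>, so this
  gives a lower \<open>\<ell>\<^sub>1\<close>-estimate, and errors that cost at most half of \<open>d * e\<close> per term do
  not destroy it.\<close>

lemma l1_sequence_ptensor_if_almost_diagonal:
  fixes x :: "nat \<Rightarrow> 'a::banach" and y :: "nat \<Rightarrow> 'b::banach"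
    and a :: "nat \<Rightarrow> 'a \<Rightarrow> real" and b :: "nat \<Rightarrow> 'b \<Rightarrow> real"
  assumes p: "1 < p" and q: "1 < q" and pq: "1 / p + 1 / q \<ge> 1"
    and lin: "\<And>k. linear (a k)" "\<And>k. linear (b k)"
    and A: "A > 0" "\<And>v n. (\<Sum>k<n. \<bar>a k v\<bar> powr p) \<le> (A * norm v) powr p"
    and B: "B > 0" "\<And>w n. (\<Sum>k<n. \<bar>b k w\<bar> powr q) \<le> (B * norm w) powr q"
    and \<kappa>: "\<kappa> \<ge> 0"
      "\<And>j n. (\<Sum>k<n. \<bar>a k (x j) - (if k = j then D j else 0)\<bar> powr p) \<le> \<kappa> powr p"
      "\<And>j n. (\<Sum>k<n. \<bar>b k (y j) - (if k = j then E j else 0)\<bar> powr q) \<le> \<kappa> powr q"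
    and D: "d > 0" "\<And>j. d \<le> D j" "\<And>j. D j \<le> M" and E: "e > 0" "\<And>j. e \<le> E j"
    and bdd: "\<And>j. norm (x j) \<le> K" "\<And>j. norm (y j) \<le> H"
    and small: "\<kappa> * (2 * (B * H) + M) \<le> d * e / 2"
  shows "l1_sequence (\<lambda>n. x n \<otimes>\<^sub>\<pi> y n)"
proof (rule l1_lower_estimate_l1_sequence)
  show "0 < d * e / (4 * A * B)" using D E A B by simp
  show "norm (x n \<otimes>\<^sub>\<pi> y n) \<le> K * H" for n
    using norm_ptensor_le[of "x n" "y n"] mult_mono[OF bdd(1)[of n] bdd(2)[of n]] norm_ge_zero
      order_trans[OF norm_ge_zero bdd(1)[of n]] by (meson order_trans)
  fix \<mu> :: "nat \<Rightarrow> real" and n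
  define F where "F v w = (\<Sum>k<n. sgn (\<mu> k) * (a k v * b k w))" for v w
  have bil: "bilinear F" unfolding bilinear_def F_def
    by (auto intro!: linearI simp: linear_add[OF lin(1)] linear_add[OF lin(2)] linear_scale[OF lin(1)]
        linear_scale[OF lin(2)] algebra_simps sum.distrib sum_distrib_left)
  have sg: "\<bar>sgn t * r\<bar> \<le> \<bar>r\<bar>" for t r :: real by (simp add: sgn_if)
  have "\<bar>F v w\<bar> \<le> 2 * A * B * (norm v * norm w)" for v w
  proof -
    have "\<bar>F v w\<bar> \<le> (\<Sum>k<n. \<bar>a k v * b k w\<bar>)"
      unfolding F_def by (rule order_trans[OF sum_abs sum_mono]) (rule sg)
    also have "\<dots> \<le> 2 * (A * norm v) * (B * norm w)"
      using A B by (intro sum_mult_le_two_exponents[OF p q pq]) auto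
    finally show ?thesis by (simp add: mult_ac)
  qed
  then have upper: "\<bar>\<Sum>j<n. \<mu> j * F (x j) (y j)\<bar> \<le> 2 * A * B * norm (\<Sum>j<n. \<mu> j *\<^sub>R (x j \<otimes>\<^sub>\<pi> y j))"
    using A B by (intro bilinear_form_le_norm_ptensor bil) auto
  have err: "\<bar>F (x j) (y j) - sgn (\<mu> j) * (D j * E j)\<bar> \<le> d * e / 2" if j: "j < n" for j
  proof -
    define \<delta> where "\<delta> k = (if k = j then 1 else 0 :: real)" for k
    have \<delta>: "\<delta> k * t = (if k = j then t else 0)" for k t by (simp add: \<delta>_def)
    \<comment> \<open>\<open>a'\<close> and \<open>b'\<close> are the deviations from the diagonal; the product of the matrices is expanded as
      \<open>a * b - \<delta> * D * E = a' * b + \<delta> * D * b'\<close>.\<close>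
    define a' b' where "a' k = a k (x j) - \<delta> k * D j" and "b' k = b k (y j) - \<delta> k * E j" for k
    have a': "(\<Sum>k<n. \<bar>a' k\<bar> powr p) \<le> \<kappa> powr p" and b': "(\<Sum>k<n. \<bar>b' k\<bar> powr q) \<le> \<kappa> powr q"
      using \<kappa>(2)[of j n] \<kappa>(3)[of j n] by (simp_all add: a'_def b'_def \<delta>)
    have Dj: "0 < D j" "D j \<le> M" using D(1) D(2)[of j] D(3)[of j] by auto
    have "\<bar>b' j\<bar> powr q \<le> (\<Sum>k<n. \<bar>b' k\<bar> powr q)" using j by (intro member_le_sum) auto
    then have "\<bar>b' j\<bar> powr q \<le> \<kappa> powr q" using b' by simp
    then have bj: "\<bar>b' j\<bar> \<le> \<kappa>" using q \<kappa>(1) by (smt (verit) powr_less_mono2)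
    have "sgn (\<mu> j) * (D j * E j) = (\<Sum>k<n. sgn (\<mu> k) * (\<delta> k * (D j * E j)))"
      using j by (simp add: \<delta>_def if_distrib[of "\<lambda>t. t * _"] if_distrib[of "\<lambda>t. _ * t"] cong: if_cong)
    then have "F (x j) (y j) - sgn (\<mu> j) * (D j * E j)
        = (\<Sum>k<n. sgn (\<mu> k) * (a k (x j) * b k (y j) - \<delta> k * (D j * E j)))"
      by (simp add: F_def right_diff_distrib sum_subtractf)
    also have "\<dots> = (\<Sum>k<n. sgn (\<mu> k) * (a' k * b k (y j) + \<delta> k * (D j * b' k)))"
      by (intro sum.cong) (auto simp: a'_def b'_def \<delta>_def algebra_simps)
    also have "\<bar>\<dots>\<bar> \<le> (\<Sum>k<n. \<bar>a' k * b k (y j) + \<delta> k * (D j * b' k)\<bar>)"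
      by (rule order_trans[OF sum_abs sum_mono]) (rule sg)
    also have "\<dots> \<le> (\<Sum>k<n. \<bar>a' k * b k (y j)\<bar> + \<delta> k * (D j * \<bar>b' k\<bar>))"
      using Dj by (intro sum_mono order_trans[OF abs_triangle_ineq]) (auto simp: \<delta>_def abs_mult)
    also have "\<dots> = (\<Sum>k<n. \<bar>a' k * b k (y j)\<bar>) + D j * \<bar>b' j\<bar>"
      using j by (simp add: sum.distrib \<delta>_def if_distrib[of "\<lambda>t. t * _"] cong: if_cong)
    also have "(\<Sum>k<n. \<bar>a' k * b k (y j)\<bar>) \<le> 2 * \<kappa> * (B * norm (y j))"
      using B \<kappa>(1) a' by (intro sum_mult_le_two_exponents[OF p q pq]) auto
    also have "\<dots> \<le> 2 * \<kappa> * (B * H)"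
      using B(1) \<kappa>(1) bdd(2) by (intro mult_left_mono) auto
    also have "D j * \<bar>b' j\<bar> \<le> M * \<kappa>"
      using Dj bj by (intro mult_mono) auto
    finally show ?thesis using small by (simp add: algebra_simps)
  qed
  have "d * e / 2 * \<bar>\<mu> j\<bar> \<le> \<mu> j * F (x j) (y j)" if j: "j < n" for j
  proof -
    have "d * e \<le> D j * E j" using D E by (intro mult_mono) (auto intro: order_trans[of 0 d] less_imp_le)
    then have 1: "d * e * \<bar>\<mu> j\<bar> \<le> D j * E j * \<bar>\<mu> j\<bar>" by (rule mult_right_mono) simp
    have eq: "\<mu> j * (F (x j) (y j) - sgn (\<mu> j) * (D j * E j))
        = \<mu> j * F (x j) (y j) - D j * E j * \<bar>\<mu> j\<bar>"
      by (simp add: right_diff_distrib abs_sgn mult_ac)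
    have "\<bar>\<mu> j * (F (x j) (y j) - sgn (\<mu> j) * (D j * E j))\<bar> \<le> \<bar>\<mu> j\<bar> * (d * e / 2)"
      unfolding abs_mult by (intro mult_left_mono err[OF j]) simp
    from abs_le_D2[OF this] show ?thesis unfolding eq using 1 by (simp add: mult.commute)
  qed
  then have "d * e / 2 * (\<Sum>j<n. \<bar>\<mu> j\<bar>) \<le> (\<Sum>j<n. \<mu> j * F (x j) (y j))"
    unfolding sum_distrib_left by (intro sum_mono) simp
  then have "d * e / 2 * (\<Sum>j<n. \<bar>\<mu> j\<bar>) \<le> 2 * A * B * norm (\<Sum>j<n. \<mu> j *\<^sub>R (x j \<otimes>\<^sub>\<pi> y j))"
    using upper by linarith
  then show "d * e / (4 * A * B) * (\<Sum>j<n. \<bar>\<mu> j\<bar>) \<le> norm (\<Sum>j<n. \<mu> j *\<^sub>R (x j \<otimes>\<^sub>\<pi> y j))"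
    using A(1) B(1) by (simp add: field_simps)
qed

section \<open>Tensors of weakly Cauchy sequences\<close>

theorem theorem3p8:
  fixes x :: "nat \<Rightarrow> 'a::banach" and y :: "nat \<Rightarrow> 'b::banach" and p q :: real
  assumes "1 < p" and "1 < q" and "1 / p + 1 / q \<ge> 1"
    and "property_R TYPE('a) p" and "property_R TYPE('b) q"
    and "weakly_Cauchy x" and "weakly_Cauchy y"
    and "\<not> (\<exists>r :: nat \<Rightarrow> nat. strict_mono r \<and> convergent (x \<circ> r))"
    and "\<not> (\<exists>r :: nat \<Rightarrow> nat. strict_mono r \<and> convergent (y \<circ> r))"
  shows "\<exists>r :: nat \<Rightarrow> nat. strict_mono r \<and> l1_sequence (\<lambda>n. x (r n) \<otimes>\<^sub>\<pi> y (r n))"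
proof -
  note p = assms(1) and q = assms(2)
  have p1: "p \<ge> 1" and q1: "q \<ge> 1" using p q by auto
  have "\<not> convergent x" using assms(8) strict_mono_id by (metis comp_id)
  then obtain u C \<xi> d and r1 :: "nat \<Rightarrow> nat" where u: "\<And>n. linear (\<lambda>x::'a. u x n)" "\<And>x. u x \<in> lp p"
      "C > 0" "\<And>x. lp_norm p (u x) \<le> C * norm x" and \<xi>: "\<xi> \<in> lp p" "\<And>k. (\<lambda>n. u (x n) k) \<longlonglongrightarrow> \<xi> k"
      and d: "d > 0" and r1: "strict_mono r1" and ud: "\<And>n. d \<le> lp_norm p (\<lambda>k. u (x (r1 n)) k - \<xi> k)"
    using property_R_operator[OF p assms(4,6)] by blast
  have "weakly_Cauchy (y \<circ> r1)"
    using assms(7) Cauchy_subseq_Cauchy[OF _ r1] unfolding weakly_Cauchy_def by (fastforce simp: o_def)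
  moreover have "\<not> convergent (y \<circ> r1)" using assms(9) r1 by blast
  ultimately obtain v C' \<eta> e and r2 :: "nat \<Rightarrow> nat" where v: "\<And>n. linear (\<lambda>x::'b. v x n)" "\<And>x. v x \<in> lp q"
      "C' > 0" "\<And>x. lp_norm q (v x) \<le> C' * norm x"
      and \<eta>: "\<eta> \<in> lp q" "\<And>k. (\<lambda>n. v ((y \<circ> r1) n) k) \<longlonglongrightarrow> \<eta> k"
      and e: "e > 0" and r2: "strict_mono r2" and ve: "\<And>n. e \<le> lp_norm q (\<lambda>k. v ((y \<circ> r1) (r2 n)) k - \<eta> k)"
    using property_R_operator[OF q assms(5)] by blast
  obtain K where K: "K > 0" "\<And>n. norm (x n) \<le> K" using weakly_Cauchy_bounded[OF assms(6)] by blast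
  obtain H where H: "H > 0" "\<And>n. norm (y n) \<le> H" using weakly_Cauchy_bounded[OF assms(7)] by blast
  define M where "M = C * K + lp_norm p \<xi>"
  have M0: "M \<ge> 0" using u(3) K(1) lp_norm_nonneg by (simp add: M_def)
  have M: "lp_norm p (\<lambda>k. u (x n) k - \<xi> k) \<le> M" for n
    using lp_diff(2)[OF p1 u(2) \<xi>(1), of "x n"] u(4)[of "x n"] mult_left_mono[OF K(2)[of n], of C] u(3)
    unfolding M_def by linarith
  define T where "T = 2 * (C' * H) + M"
  have T: "T > 0" using v(3) H(1) M0 by (simp add: T_def add_pos_nonneg)
  \<comment> \<open>The first two bounds keep the diagonal entries above \<open>d / 2\<close> and \<open>e / 2\<close>; the last one makes the
    total error \<open>3 * \<kappa> * T\<close> at most half of the product \<open>(d / 2) * (e / 2)\<close>.\<close>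
  define \<kappa> where "\<kappa> = min (min (d / 4) (e / 4)) (d * e / (24 * T))"
  have \<kappa>: "\<kappa> > 0" "\<kappa> \<le> d / 4" "\<kappa> \<le> e / 4" "\<kappa> \<le> d * e / (24 * T)" using d e T by (auto simp: \<kappa>_def)
  have "3 * \<kappa> * T \<le> 3 * (d * e / (24 * T)) * T" using \<kappa>(4) T by (intro mult_right_mono) auto
  also have "\<dots> = (d / 2) * (e / 2) / 2" using T by simp
  finally have small: "3 * \<kappa> * (2 * (C' * H) + M) \<le> (d / 2) * (e / 2) / 2" unfolding T_def .
  define s where "s = r1 \<circ> r2"
  have s: "strict_mono s" unfolding s_def using r1 r2 by (rule strict_mono_o)
  define f g where "f n = u (x (s n))" and "g n = v (y (s n))" for n
  have f0: "(\<lambda>n. f n i - \<xi> i) \<longlonglongrightarrow> 0" for i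
    using LIMSEQ_subseq_LIMSEQ[OF \<xi>(2)[of i] s] by (simp add: f_def o_def LIM_zero)
  have g0: "(\<lambda>n. g n i - \<eta> i) \<longlonglongrightarrow> 0" for i
    using LIMSEQ_subseq_LIMSEQ[OF \<eta>(2)[of i] r2] by (simp add: g_def s_def o_def LIM_zero)
  have fd: "d \<le> lp_norm p (\<lambda>i. f n i - \<xi> i)" and ge: "e \<le> lp_norm q (\<lambda>i. g n i - \<eta> i)" for n
    using ud[of "r2 n"] ve[of n] by (simp_all add: f_def g_def s_def)
  \<comment> \<open>The limits \<open>\<xi>\<close> and \<open>\<eta>\<close> need not vanish, but the blocks may start so late that they are small
    there.\<close>
  obtain N0 where N0: "lp_norm p (\<lambda>i. if i < N0 then 0 else \<xi> i) \<le> \<kappa>"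
      "lp_norm q (\<lambda>i. if i < N0 then 0 else \<eta> i) \<le> \<kappa>"
    using eventually_happens[OF eventually_conj[OF lp_tail_small[OF p1 \<xi>(1) \<kappa>(1)] lp_tail_small[OF q1 \<eta>(1) \<kappa>(1)]]]
    by auto
  obtain r N where r: "strict_mono (r :: nat \<Rightarrow> nat)" and N: "strict_mono N" "N 0 = N0"
    and P: "\<And>k. lp_norm p (\<lambda>i. if i < N k then f (r k) i - \<xi> i else 0) \<le> \<kappa> \<and>
        lp_norm q (\<lambda>i. if i < N k then g (r k) i - \<eta> i else 0) \<le> \<kappa>"
    and Q: "\<And>k. lp_norm p (\<lambda>i. if i < N (Suc k) then 0 else f (r k) i - \<xi> i) \<le> \<kappa> \<and>
        lp_norm q (\<lambda>i. if i < N (Suc k) then 0 else g (r k) i - \<eta> i) \<le> \<kappa>"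
  proof (rule gliding_hump[of
      "\<lambda>n N. lp_norm p (\<lambda>i. if i < N then f n i - \<xi> i else 0) \<le> \<kappa> \<and>
        lp_norm q (\<lambda>i. if i < N then g n i - \<eta> i else 0) \<le> \<kappa>"
      "\<lambda>n N. lp_norm p (\<lambda>i. if i < N then 0 else f n i - \<xi> i) \<le> \<kappa> \<and>
        lp_norm q (\<lambda>i. if i < N then 0 else g n i - \<eta> i) \<le> \<kappa>" N0])
    show "\<forall>\<^sub>F n in sequentially. lp_norm p (\<lambda>i. if i < N then f n i - \<xi> i else 0) \<le> \<kappa> \<and>
        lp_norm q (\<lambda>i. if i < N then g n i - \<eta> i else 0) \<le> \<kappa>" for N
      by (intro eventually_conj lp_head_small p1 q1 f0 g0 \<kappa>(1))
    show "\<forall>\<^sub>F N in sequentially. lp_norm p (\<lambda>i. if i < N then 0 else f n i - \<xi> i) \<le> \<kappa> \<and>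
        lp_norm q (\<lambda>i. if i < N then 0 else g n i - \<eta> i) \<le> \<kappa>" for n
      unfolding f_def g_def by (intro eventually_conj lp_tail_small lp_diff(1) p1 q1 u(2) v(2) \<xi>(1) \<eta>(1) \<kappa>(1))
  qed blast
  obtain \<alpha> D where \<alpha>: "\<And>h n. h \<in> lp p \<Longrightarrow>
       (\<Sum>k<n. \<bar>\<Sum>i\<in>{N k..<N (Suc k)}. \<alpha> k i * h i\<bar> powr p) \<le> lp_norm p h powr p"
    "\<And>j n. (\<Sum>k<n. \<bar>(\<Sum>i\<in>{N k..<N (Suc k)}. \<alpha> k i * f (r j) i) - (if k = j then D j else 0)\<bar> powr p)
       \<le> (3 * \<kappa>) powr p"
    and D: "\<And>j. lp_norm p (\<lambda>i. f (r j) i - \<xi> i) - 2 * \<kappa> \<le> D j" "\<And>j. D j \<le> lp_norm p (\<lambda>i. f (r j) i - \<xi> i)"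
  proof (rule almost_diagonal_block_functionals[of p "\<lambda>j. f (r j)" \<xi> N \<kappa>])
  qed (use p u(2) \<xi> N N0 P Q in \<open>auto simp: f_def\<close>)
  obtain \<beta> E where \<beta>: "\<And>h n. h \<in> lp q \<Longrightarrow>
       (\<Sum>k<n. \<bar>\<Sum>i\<in>{N k..<N (Suc k)}. \<beta> k i * h i\<bar> powr q) \<le> lp_norm q h powr q"
    "\<And>j n. (\<Sum>k<n. \<bar>(\<Sum>i\<in>{N k..<N (Suc k)}. \<beta> k i * g (r j) i) - (if k = j then E j else 0)\<bar> powr q)
       \<le> (3 * \<kappa>) powr q"
    and E: "\<And>j. lp_norm q (\<lambda>i. g (r j) i - \<eta> i) - 2 * \<kappa> \<le> E j"
  proof (rule almost_diagonal_block_functionals[of q "\<lambda>j. g (r j)" \<eta> N \<kappa>])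
  qed (use q v(2) \<eta> N N0 P Q in \<open>auto simp: g_def\<close>)
  define a where "a k w = (\<Sum>i\<in>{N k..<N (Suc k)}. \<alpha> k i * u w i)" for k w
  define b where "b k w = (\<Sum>i\<in>{N k..<N (Suc k)}. \<beta> k i * v w i)" for k w
  have "l1_sequence (\<lambda>n. x (s (r n)) \<otimes>\<^sub>\<pi> y (s (r n)))"
  proof (rule l1_sequence_ptensor_if_almost_diagonal[OF p q assms(3),
        where a = a and b = b and A = C and B = C' and \<kappa> = "3 * \<kappa>" and D = D and E = E
          and d = "d / 2" and e = "e / 2" and M = M and K = K and H = H])
    show "linear (a k)" for k
      unfolding a_def by (intro linear_compose_sum ballI linear_compose_scale_right[where 'a='a and 'b=real, simplified] u(1))
    show "linear (b k)" for k
      unfolding b_def by (intro linear_compose_sum ballI linear_compose_scale_right[where 'a='b and 'b=real, simplified] v(1))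
    show "(\<Sum>k<n. \<bar>a k w\<bar> powr p) \<le> (C * norm w) powr p" for w n
      unfolding a_def using p u(4) lp_norm_nonneg by (intro order_trans[OF \<alpha>(1)] u(2) powr_mono2) auto
    show "(\<Sum>k<n. \<bar>b k w\<bar> powr q) \<le> (C' * norm w) powr q" for w n
      unfolding b_def using q v(4) lp_norm_nonneg by (intro order_trans[OF \<beta>(1)] v(2) powr_mono2) auto
    show "(\<Sum>k<n. \<bar>a k (x (s (r j))) - (if k = j then D j else 0)\<bar> powr p) \<le> (3 * \<kappa>) powr p" for j n
      using \<alpha>(2)[where j=j and n=n] by (simp add: a_def f_def)
    show "(\<Sum>k<n. \<bar>b k (y (s (r j))) - (if k = j then E j else 0)\<bar> powr q) \<le> (3 * \<kappa>) powr q" for j n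
      using \<beta>(2)[where j=j and n=n] by (simp add: b_def g_def)
    show "d / 2 \<le> D j" for j using D(1)[of j] fd[of "r j"] \<kappa>(2) by linarith
    show "e / 2 \<le> E j" for j using E[of j] ge[of "r j"] \<kappa>(3) by linarith
    show "D j \<le> M" for j using D(2)[of j] M[of "s (r j)"] by (simp add: f_def)
  qed (use small K H u(3) v(3) d e \<kappa>(1) in auto)
  moreover have "strict_mono (s \<circ> r)" using s r by (rule strict_mono_o)
  ultimately show ?thesis by (intro exI[of _ "s \<circ> r"]) simp
qed

end
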